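(* Let $\mathsf G\colon\mathscr A\to\mathscr B$ be an exact functor between triangulated categories. (a) If $\mathsf F\colon\mathscr B\to\mathscr A$ is a right adjoint of $\mathsf G$ such that the natural morphism $\mathsf G\mathsf F\to\mathrm{id}_{\mathscr B}$ is an isomorphism, then $(\mathrm{Im}\,\mathsf F,\ker\mathsf G)$ is a semi-orthogonal decomposition of $\mathscr A$. (b) If $\mathsf F\colon\mathscr B\to\mathscr A$ is a left adjoint of $\mathsf G$ such that the natural morphism $\mathrm{id}_{\mathscr B}\to\mathsf G\mathsf F$ is an isomorphism, then $(\ker\mathsf G,\mathrm{Im}\,\mathsf F)$ is a semi-orthogonal decomposition of $\mathscr A$.
   Context: $\mathrm{Im}\,\mathsf F$ is the essential image of $\mathsf F$, i.e. the full subcategory of objects isomorphic to some $\mathsf F B$; $\ker\mathsf G$ is the full subcategory of objects $A$ with $\mathsf G A\simeq0$. A sequence $(\mathscr A_1,\dots,\mathscr A_m)$ of triangulated subcategories of a triangulated category $\mathscr A$ is a semi-orthogonal decomposition of $\mathscr A$ if $\mathrm{Hom}(A,A')=0$ for $A\in\mathscr A_i$, $A'\in\mathscr A_j$, $i>j$, and for every object $A\in\mathscr A$ there is a chain of morphisms $0=A_m\xrightarrow{f_m}A_{m-1}\xrightarrow{f_{m-1}}\cdots\xrightarrow{f_2}A_1\xrightarrow{f_1}A_0=A$ such that $\mathrm{Cone}\,f_i\in\mathscr A_i$. *)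

theory Defs
  imports "HOL-Algebra.Group"
begin

section \<open>Categories and functors\<close>

record ('o, 'm) category =
  Obj :: "'o set"
  Arr :: "'m set"
  Dom :: "'m \<Rightarrow> 'o"
  Cod :: "'m \<Rightarrow> 'o"
  Ident :: "'o \<Rightarrow> 'm"
  Comp :: "'m \<Rightarrow> 'm \<Rightarrow> 'm"  (infixl "\<cdot>\<index>" 70)

definition Hom :: "('o, 'm, 'x) category_scheme \<Rightarrow> 'o \<Rightarrow> 'o \<Rightarrow> 'm set" where
  "Hom C X Y = {f \<in> Arr C. Dom C f = X \<and> Cod C f = Y}"

locale category =
  fixes C :: "('o, 'm, 'x) category_scheme" (structure)
  assumes Dom_closed: "f \<in> Arr C \<Longrightarrow> Dom C f \<in> Obj C"
    and Cod_closed: "f \<in> Arr C \<Longrightarrow> Cod C f \<in> Obj C"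
    and Ident_in_Hom: "X \<in> Obj C \<Longrightarrow> Ident C X \<in> Hom C X X"
    and Comp_in_Hom: "\<lbrakk>f \<in> Hom C X Y; g \<in> Hom C Y Z\<rbrakk> \<Longrightarrow> g \<cdot> f \<in> Hom C X Z"
    and Comp_Ident: "f \<in> Hom C X Y \<Longrightarrow> f \<cdot> Ident C X = f"
    and Ident_Comp: "f \<in> Hom C X Y \<Longrightarrow> Ident C Y \<cdot> f = f"
    and Comp_assoc: "\<lbrakk>f \<in> Hom C X Y; g \<in> Hom C Y Z; h \<in> Hom C Z W\<rbrakk>
      \<Longrightarrow> (h \<cdot> g) \<cdot> f = h \<cdot> (g \<cdot> f)"

definition isomorphism :: "('o, 'm, 'x) category_scheme \<Rightarrow> 'o \<Rightarrow> 'o \<Rightarrow> 'm \<Rightarrow> bool" where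
  "isomorphism C X Y f \<longleftrightarrow> f \<in> Hom C X Y \<and>
     (\<exists>g \<in> Hom C Y X. g \<cdot>\<^bsub>C\<^esub> f = Ident C X \<and> f \<cdot>\<^bsub>C\<^esub> g = Ident C Y)"

definition isomorphic :: "('o, 'm, 'x) category_scheme \<Rightarrow> 'o \<Rightarrow> 'o \<Rightarrow> bool" where
  "isomorphic C X Y \<longleftrightarrow> (\<exists>f. isomorphism C X Y f)"

definition zero_object :: "('o, 'm, 'x) category_scheme \<Rightarrow> 'o \<Rightarrow> bool" where
  "zero_object C Z \<longleftrightarrow> Z \<in> Obj C \<and>
     (\<forall>X \<in> Obj C. (\<exists>!f. f \<in> Hom C X Z) \<and> (\<exists>!f. f \<in> Hom C Z X))"

record ('o, 'm, 'p, 'n) ftor =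
  map_obj :: "'o \<Rightarrow> 'p"
  map_arr :: "'m \<Rightarrow> 'n"

definition id_ftor :: "('o, 'm, 'o, 'm) ftor" where
  "id_ftor = \<lparr>map_obj = (\<lambda>X. X), map_arr = (\<lambda>f. f)\<rparr>"

definition comp_ftor ::
  "('p, 'n, 'q, 'k) ftor \<Rightarrow> ('o, 'm, 'p, 'n) ftor \<Rightarrow> ('o, 'm, 'q, 'k) ftor"
  (infixl "\<circ>\<^sub>F" 55) where
  "K \<circ>\<^sub>F F = \<lparr>map_obj = map_obj K \<circ> map_obj F, map_arr = map_arr K \<circ> map_arr F\<rparr>"

definition is_functor ::
  "('o, 'm, 'x) category_scheme \<Rightarrow> ('p, 'n, 'y) category_scheme \<Rightarrow> ('o, 'm, 'p, 'n) ftor \<Rightarrow> bool"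
  where
  "is_functor C D F \<longleftrightarrow>
     (\<forall>X \<in> Obj C. map_obj F X \<in> Obj D) \<and>
     (\<forall>X Y. \<forall>f \<in> Hom C X Y. map_arr F f \<in> Hom D (map_obj F X) (map_obj F Y)) \<and>
     (\<forall>X \<in> Obj C. map_arr F (Ident C X) = Ident D (map_obj F X)) \<and>
     (\<forall>X Y Z. \<forall>f \<in> Hom C X Y. \<forall>g \<in> Hom C Y Z.
        map_arr F (g \<cdot>\<^bsub>C\<^esub> f) = map_arr F g \<cdot>\<^bsub>D\<^esub> map_arr F f)"

definition nat_trans ::
  "('o, 'm, 'x) category_scheme \<Rightarrow> ('p, 'n, 'y) category_scheme \<Rightarrow>
   ('o, 'm, 'p, 'n) ftor \<Rightarrow> ('o, 'm, 'p, 'n) ftor \<Rightarrow> ('o \<Rightarrow> 'n) \<Rightarrow> bool" where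
  "nat_trans C D F K \<tau> \<longleftrightarrow>
     (\<forall>X \<in> Obj C. \<tau> X \<in> Hom D (map_obj F X) (map_obj K X)) \<and>
     (\<forall>X Y. \<forall>f \<in> Hom C X Y. \<tau> Y \<cdot>\<^bsub>D\<^esub> map_arr F f = map_arr K f \<cdot>\<^bsub>D\<^esub> \<tau> X)"

definition nat_iso ::
  "('o, 'm, 'x) category_scheme \<Rightarrow> ('p, 'n, 'y) category_scheme \<Rightarrow>
   ('o, 'm, 'p, 'n) ftor \<Rightarrow> ('o, 'm, 'p, 'n) ftor \<Rightarrow> ('o \<Rightarrow> 'n) \<Rightarrow> bool" where
  "nat_iso C D F K \<tau> \<longleftrightarrow> nat_trans C D F K \<tau> \<and>
     (\<forall>X \<in> Obj C. isomorphism D (map_obj F X) (map_obj K X) (\<tau> X))"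

definition equivalence ::
  "('o, 'm, 'x) category_scheme \<Rightarrow> ('p, 'n, 'y) category_scheme \<Rightarrow> ('o, 'm, 'p, 'n) ftor \<Rightarrow> bool"
  where
  "equivalence C D F \<longleftrightarrow> is_functor C D F \<and>
     (\<exists>K. is_functor D C K \<and>
        (\<exists>\<alpha>. nat_iso C C (K \<circ>\<^sub>F F) id_ftor \<alpha>) \<and>
        (\<exists>\<beta>. nat_iso D D (F \<circ>\<^sub>F K) id_ftor \<beta>))"

text \<open>\<open>L : C \<rightarrow> D\<close> is left adjoint to \<open>R : D \<rightarrow> C\<close> with unit \<open>\<eta> : id \<rightarrow> R L\<close> and counit
  \<open>\<epsilon> : L R \<rightarrow> id\<close>.\<close>

definition adjunction ::
  "('o, 'm, 'x) category_scheme \<Rightarrow> ('p, 'n, 'y) category_scheme \<Rightarrow>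
   ('o, 'm, 'p, 'n) ftor \<Rightarrow> ('p, 'n, 'o, 'm) ftor \<Rightarrow> ('o \<Rightarrow> 'm) \<Rightarrow> ('p \<Rightarrow> 'n) \<Rightarrow> bool" where
  "adjunction C D L R \<eta> \<epsilon> \<longleftrightarrow>
     is_functor C D L \<and> is_functor D C R \<and>
     nat_trans C C id_ftor (R \<circ>\<^sub>F L) \<eta> \<and>
     nat_trans D D (L \<circ>\<^sub>F R) id_ftor \<epsilon> \<and>
     (\<forall>X \<in> Obj C. \<epsilon> (map_obj L X) \<cdot>\<^bsub>D\<^esub> map_arr L (\<eta> X) = Ident D (map_obj L X)) \<and>
     (\<forall>Y \<in> Obj D. map_arr R (\<epsilon> Y) \<cdot>\<^bsub>C\<^esub> \<eta> (map_obj R Y) = Ident C (map_obj R Y))"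

section \<open>Additive categories\<close>

record ('o, 'm) additive_category = "('o, 'm) category" +
  Add :: "'m \<Rightarrow> 'm \<Rightarrow> 'm"
  Zero :: "'o \<Rightarrow> 'o \<Rightarrow> 'm"

definition hom_group ::
  "('o, 'm, 'x) additive_category_scheme \<Rightarrow> 'o \<Rightarrow> 'o \<Rightarrow> 'm monoid" where
  "hom_group C X Y = \<lparr>carrier = Hom C X Y, monoid.mult = Add C, one = Zero C X Y\<rparr>"

definition Neg :: "('o, 'm, 'x) additive_category_scheme \<Rightarrow> 'm \<Rightarrow> 'm" where
  "Neg C f = inv\<^bsub>hom_group C (Dom C f) (Cod C f)\<^esub> f"

definition biproduct ::
  "('o, 'm, 'x) additive_category_scheme \<Rightarrow> 'o \<Rightarrow> 'o \<Rightarrow> 'o \<Rightarrow> 'm \<Rightarrow> 'm \<Rightarrow> 'm \<Rightarrow> 'm \<Rightarrow> bool" where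
  "biproduct C X Y S i j p q \<longleftrightarrow>
     i \<in> Hom C X S \<and> j \<in> Hom C Y S \<and> p \<in> Hom C S X \<and> q \<in> Hom C S Y \<and>
     p \<cdot>\<^bsub>C\<^esub> i = Ident C X \<and> q \<cdot>\<^bsub>C\<^esub> j = Ident C Y \<and>
     q \<cdot>\<^bsub>C\<^esub> i = Zero C X Y \<and> p \<cdot>\<^bsub>C\<^esub> j = Zero C Y X \<and>
     Add C (i \<cdot>\<^bsub>C\<^esub> p) (j \<cdot>\<^bsub>C\<^esub> q) = Ident C S"

locale additive_category = category C
  for C :: "('o, 'm, 'x) additive_category_scheme" (structure) +
  assumes hom_comm_group: "\<lbrakk>X \<in> Obj C; Y \<in> Obj C\<rbrakk> \<Longrightarrow> comm_group (hom_group C X Y)"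
    and Comp_Add: "\<lbrakk>f \<in> Hom C X Y; f' \<in> Hom C X Y; g \<in> Hom C Y Z\<rbrakk>
      \<Longrightarrow> g \<cdot> Add C f f' = Add C (g \<cdot> f) (g \<cdot> f')"
    and Add_Comp: "\<lbrakk>f \<in> Hom C X Y; g \<in> Hom C Y Z; g' \<in> Hom C Y Z\<rbrakk>
      \<Longrightarrow> Add C g g' \<cdot> f = Add C (g \<cdot> f) (g' \<cdot> f)"
    and ex_zero_object: "\<exists>Z. zero_object C Z"
    and ex_biproduct: "\<lbrakk>X \<in> Obj C; Y \<in> Obj C\<rbrakk> \<Longrightarrow> \<exists>S i j p q. biproduct C X Y S i j p q"

definition additive_functor ::
  "('o, 'm, 'x) additive_category_scheme \<Rightarrow> ('p, 'n, 'y) additive_category_scheme \<Rightarrow>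
   ('o, 'm, 'p, 'n) ftor \<Rightarrow> bool" where
  "additive_functor C D F \<longleftrightarrow> is_functor C D F \<and>
     (\<forall>X \<in> Obj C. \<forall>Y \<in> Obj C.
        map_arr F \<in> hom (hom_group C X Y) (hom_group D (map_obj F X) (map_obj F Y)))"

section \<open>Triangulated categories\<close>

text \<open>A triangle \<open>X \<rightarrow> Y \<rightarrow> Z \<rightarrow> X[1]\<close> is recorded by its three morphisms, and \<open>Tri\<close> is the class
  of distinguished triangles. The shift is only required to be an additive autoequivalence,
  which includes the convention that it is an automorphism.\<close>

record ('o, 'm) triangulated_category = "('o, 'm) additive_category" +
  Shift :: "('o, 'm, 'o, 'm) ftor"
  Tri :: "('m \<times> 'm \<times> 'm) set"

abbreviation sh_obj :: "('o, 'm, 'x) triangulated_category_scheme \<Rightarrow> 'o \<Rightarrow> 'o" where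
  "sh_obj C \<equiv> map_obj (Shift C)"

abbreviation sh_arr :: "('o, 'm, 'x) triangulated_category_scheme \<Rightarrow> 'm \<Rightarrow> 'm" where
  "sh_arr C \<equiv> map_arr (Shift C)"

definition triangle ::
  "('o, 'm, 'x) triangulated_category_scheme \<Rightarrow> 'o \<Rightarrow> 'o \<Rightarrow> 'o \<Rightarrow> 'm \<Rightarrow> 'm \<Rightarrow> 'm \<Rightarrow> bool" where
  "triangle C X Y Z f g h \<longleftrightarrow>
     f \<in> Hom C X Y \<and> g \<in> Hom C Y Z \<and> h \<in> Hom C Z (sh_obj C X)"

definition dist_triangle ::
  "('o, 'm, 'x) triangulated_category_scheme \<Rightarrow> 'o \<Rightarrow> 'o \<Rightarrow> 'o \<Rightarrow> 'm \<Rightarrow> 'm \<Rightarrow> 'm \<Rightarrow> bool" where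
  "dist_triangle C X Y Z f g h \<longleftrightarrow> triangle C X Y Z f g h \<and> (f, g, h) \<in> Tri C"

locale triangulated_category = additive_category C
  for C :: "('o, 'm, 'x) triangulated_category_scheme" (structure) +
  assumes Shift_additive: "additive_functor C C (Shift C)"
    and Shift_equivalence: "equivalence C C (Shift C)"
    and Tri_triangle: "(f, g, h) \<in> Tri C \<Longrightarrow> \<exists>X Y Z. triangle C X Y Z f g h"
    and TR1_Ident: "\<lbrakk>X \<in> Obj C; zero_object C Z\<rbrakk>
      \<Longrightarrow> dist_triangle C X X Z (Ident C X) (Zero C X Z) (Zero C Z (sh_obj C X))"
    and TR1_iso: "\<lbrakk>dist_triangle C X Y Z f g h; triangle C X' Y' Z' f' g' h';
        isomorphism C X X' a; isomorphism C Y Y' b; isomorphism C Z Z' c;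
        b \<cdot> f = f' \<cdot> a; c \<cdot> g = g' \<cdot> b; sh_arr C a \<cdot> h = h' \<cdot> c\<rbrakk>
      \<Longrightarrow> dist_triangle C X' Y' Z' f' g' h'"
    and TR1_cone: "f \<in> Hom C X Y \<Longrightarrow> \<exists>Z g h. dist_triangle C X Y Z f g h"
    and TR2: "triangle C X Y Z f g h \<Longrightarrow>
      dist_triangle C X Y Z f g h \<longleftrightarrow>
      dist_triangle C Y Z (sh_obj C X) g h (Neg C (sh_arr C f))"
    and TR3: "\<lbrakk>dist_triangle C X Y Z f g h; dist_triangle C X' Y' Z' f' g' h';
        a \<in> Hom C X X'; b \<in> Hom C Y Y'; b \<cdot> f = f' \<cdot> a\<rbrakk>
      \<Longrightarrow> \<exists>c \<in> Hom C Z Z'. c \<cdot> g = g' \<cdot> b \<and> sh_arr C a \<cdot> h = h' \<cdot> c"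
    and TR4: "\<lbrakk>dist_triangle C X Y U f f1 f2; dist_triangle C Y Z W g g1 g2;
        dist_triangle C X Z V (g \<cdot> f) k1 k2\<rbrakk>
      \<Longrightarrow> \<exists>u v. dist_triangle C U V W u v (sh_arr C f1 \<cdot> g2) \<and>
            u \<cdot> f1 = k1 \<cdot> g \<and> k2 \<cdot> u = f2 \<and>
            v \<cdot> k1 = g1 \<and> g2 \<cdot> v = sh_arr C f \<cdot> k2"

text \<open>A natural isomorphism \<open>\<theta> : F \<circ> [1] \<rightarrow> [1] \<circ> F\<close> identifies \<open>F (X[1])\<close> with \<open>(F X)[1]\<close>.\<close>

definition exact_functor ::
  "('o, 'm, 'x) triangulated_category_scheme \<Rightarrow> ('p, 'n, 'y) triangulated_category_scheme \<Rightarrow>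
   ('o, 'm, 'p, 'n) ftor \<Rightarrow> bool" where
  "exact_functor C D F \<longleftrightarrow> additive_functor C D F \<and>
     (\<exists>\<theta>. nat_iso C D (F \<circ>\<^sub>F Shift C) (Shift D \<circ>\<^sub>F F) \<theta> \<and>
        (\<forall>X Y Z f g h. dist_triangle C X Y Z f g h \<longrightarrow>
           dist_triangle D (map_obj F X) (map_obj F Y) (map_obj F Z)
             (map_arr F f) (map_arr F g) (\<theta> X \<cdot>\<^bsub>D\<^esub> map_arr F h)))"

section \<open>Semi-orthogonal decompositions\<close>

text \<open>Full subcategories are represented by their sets of objects. Triangulated subcategories are
  taken to be strictly full; as \<open>S\<close> is closed under isomorphism and the shift is essentially
  surjective, the equivalence in the third conjunct is closure under \<open>[1]\<close> and \<open>[-1]\<close>.\<close>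

definition triangulated_subcategory ::
  "('o, 'm, 'x) triangulated_category_scheme \<Rightarrow> 'o set \<Rightarrow> bool" where
  "triangulated_subcategory C S \<longleftrightarrow>
     S \<subseteq> Obj C \<and>
     (\<forall>X Y. X \<in> S \<and> isomorphic C X Y \<longrightarrow> Y \<in> S) \<and>
     (\<forall>X \<in> Obj C. sh_obj C X \<in> S \<longleftrightarrow> X \<in> S) \<and>
     (\<exists>Z \<in> S. zero_object C Z) \<and>
     (\<forall>X Y Z f g h. dist_triangle C X Y Z f g h \<and> X \<in> S \<and> Y \<in> S \<longrightarrow> Z \<in> S)"

text \<open>The \<open>i\<close>-th component is \<open>As ! (i - 1)\<close>. The cone of a morphism is the third vertex of any
  distinguished triangle on it, so it is determined up to isomorphism; which one is chosen does
  not matter, since the components are closed under isomorphism.\<close>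

definition semiorthogonal_decomposition ::
  "('o, 'm, 'x) triangulated_category_scheme \<Rightarrow> 'o set list \<Rightarrow> bool" where
  "semiorthogonal_decomposition C As \<longleftrightarrow>
     (\<forall>S \<in> set As. triangulated_subcategory C S) \<and>
     (\<forall>i \<in> {1..length As}. \<forall>j \<in> {1..length As}. i > j \<longrightarrow>
        (\<forall>X \<in> As ! (i - 1). \<forall>Y \<in> As ! (j - 1). Hom C X Y = {Zero C X Y})) \<and>
     (\<forall>A \<in> Obj C. \<exists>X f. X 0 = A \<and> zero_object C (X (length As)) \<and>
        (\<forall>i \<in> {1..length As}. f i \<in> Hom C (X i) (X (i - 1)) \<and>
           (\<exists>Z g h. dist_triangle C (X i) (X (i - 1)) Z (f i) g h \<and> Z \<in> As ! (i - 1))))"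

definition essential_image ::
  "('p, 'n, 'y) category_scheme \<Rightarrow> ('o, 'm, 'x) category_scheme \<Rightarrow> ('p, 'n, 'o, 'm) ftor \<Rightarrow> 'o set"
  where
  "essential_image D C F = {X \<in> Obj C. \<exists>Y \<in> Obj D. isomorphic C X (map_obj F Y)}"

definition functor_kernel ::
  "('o, 'm, 'x) category_scheme \<Rightarrow> ('p, 'n, 'y) category_scheme \<Rightarrow> ('o, 'm, 'p, 'n) ftor \<Rightarrow> 'o set"
  where
  "functor_kernel C D F = {X \<in> Obj C. \<exists>Z. zero_object D Z \<and> isomorphic D (map_obj F X) Z}"

end

theory Submission
  imports Defs
begin

text \<open>Both parts are instances of one criterion about a pair \<open>(S, T)\<close> of sets of objects that are
  closed under isomorphism: if \<open>Hom(S, T) = 0\<close>, if every object \<open>M\<close> sits in a distinguished triangle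
  \<open>X \<rightarrow> M \<rightarrow> Y \<rightarrow> X[1]\<close> with \<open>X \<in> S\<close> and \<open>Y \<in> T\<close>, and if one of \<open>S\<close>, \<open>T\<close> is stable under the shift
  and its inverse, then \<open>(T, S)\<close> is a semi-orthogonal decomposition
  (\<open>semiorthogonal_decompositionI\<close>). The triangles force \<open>T = S\<^sup>\<bottom>\<close> and \<open>S = \<^sup>\<bottom>T\<close>: if an object \<open>M\<close> is
  orthogonal to one side, then one of the two maps \<open>X \<rightarrow> M\<close> and \<open>M \<rightarrow> Y\<close> vanishes, and together with
  \<open>Hom(X[1], Y) = 0\<close> this makes the connecting map vanish as well, so that the other map is an
  isomorphism. The orthogonal of a shift-stable set is a triangulated subcategory by
  the long exact \<open>Hom\<close> sequences.

  For the theorem, one of the two sets is \<open>ker G\<close>, which is shift-stable because \<open>G\<close> is exact, and the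
  other is \<open>Im F\<close>. Orthogonality is the adjunction isomorphism: \<open>Hom(X, F Y) \<cong> Hom(G X, Y) = 0\<close> for
  \<open>G X = 0\<close>, and dually. The triangle for \<open>M\<close> is obtained by completing the unit \<open>M \<rightarrow> F G M\<close> to a
  triangle \<open>X \<rightarrow> M \<rightarrow> F G M \<rightarrow> X[1]\<close> in part (a), and the counit \<open>F G M \<rightarrow> M\<close> to a triangle
  \<open>F G M \<rightarrow> M \<rightarrow> X \<rightarrow> (F G M)[1]\<close> in part (b). By the triangle identities, \<open>G\<close> turns this unit or
  counit into a one-sided inverse of the natural isomorphism between \<open>G F\<close> and \<open>id\<close>, hence into an
  isomorphism, and therefore \<open>G X = 0\<close>.

  That \<open>Im F\<close> is a triangulated subcategory thus comes from its being an orthogonal of \<open>ker G\<close>, not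
  from a study of how \<open>F\<close> acts on shifts and triangles.\<close>

section \<open>Isomorphisms and equivalences\<close>

definition closed_under_isomorphism :: "('o, 'm, 'x) category_scheme \<Rightarrow> 'o set \<Rightarrow> bool" where
  "closed_under_isomorphism C S \<longleftrightarrow>
     S \<subseteq> Obj C \<and> (\<forall>X Y. X \<in> S \<and> isomorphic C X Y \<longrightarrow> Y \<in> S)"

lemma closed_under_isomorphism_subset: "closed_under_isomorphism C S \<Longrightarrow> S \<subseteq> Obj C"
  unfolding closed_under_isomorphism_def by blast

lemma closed_under_isomorphismD:
  "closed_under_isomorphism C S \<Longrightarrow> X \<in> S \<Longrightarrow> isomorphic C X Y \<Longrightarrow> Y \<in> S"
  unfolding closed_under_isomorphism_def by blast

context category
begin

lemma Hom_Obj: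
  assumes "f \<in> Hom C X Y"
  shows "X \<in> Obj C" "Y \<in> Obj C"
  using assms Dom_closed Cod_closed by (auto simp: Hom_def)

lemma isomorphismE:
  assumes "isomorphism C X Y f"
  obtains g where "f \<in> Hom C X Y" "g \<in> Hom C Y X" "g \<cdot> f = Ident C X" "f \<cdot> g = Ident C Y"
  using assms by (auto simp: isomorphism_def)

lemma isomorphismI_inverses:
  assumes f: "f \<in> Hom C X Y" and l: "l \<in> Hom C Y X" and r: "r \<in> Hom C Y X"
    and lf: "l \<cdot> f = Ident C X" and fr: "f \<cdot> r = Ident C Y"
  shows "isomorphism C X Y f"
proof -
  have "l = l \<cdot> (f \<cdot> r)" using Comp_Ident[OF l] fr by simp
  also have "\<dots> = r" using Comp_assoc[OF r f l] lf Ident_Comp[OF r] by simp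
  finally show ?thesis using assms by (auto simp: isomorphism_def)
qed

lemma isomorphism_cancel_right:
  assumes a: "isomorphism C W X a" and f: "f \<in> Hom C X Y" and g: "g \<in> Hom C X Y"
    and eq: "f \<cdot> a = g \<cdot> a"
  shows "f = g"
proof -
  obtain b where b: "a \<in> Hom C W X" "b \<in> Hom C X W" "a \<cdot> b = Ident C X"
    using a by (rule isomorphismE)
  have "k \<cdot> a \<cdot> b = k" if "k \<in> Hom C X Y" for k
    using Comp_assoc[OF b(2,1) that] Comp_Ident[OF that] b(3) by simp
  then show ?thesis using f g eq by metis
qed

lemma isomorphic_refl: "X \<in> Obj C \<Longrightarrow> isomorphic C X X"
  using isomorphismI_inverses[of "Ident C X" X X "Ident C X" "Ident C X"] Ident_in_Hom[of X]
    Comp_Ident[of "Ident C X" X X]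
  by (auto simp: isomorphic_def)

lemma isomorphic_sym: "isomorphic C X Y \<Longrightarrow> isomorphic C Y X"
  by (auto simp: isomorphic_def isomorphism_def)

lemma isomorphism_comp:
  assumes "isomorphism C X Y f" "isomorphism C Y Z g"
  shows "isomorphism C X Z (g \<cdot> f)"
proof -
  obtain f' where f: "f \<in> Hom C X Y" "f' \<in> Hom C Y X" "f' \<cdot> f = Ident C X" "f \<cdot> f' = Ident C Y"
    using assms(1) by (rule isomorphismE)
  obtain g' where g: "g \<in> Hom C Y Z" "g' \<in> Hom C Z Y" "g' \<cdot> g = Ident C Y" "g \<cdot> g' = Ident C Z"
    using assms(2) by (rule isomorphismE)
  have gf: "g \<cdot> f \<in> Hom C X Z" and fg: "f' \<cdot> g' \<in> Hom C Z X"
    using f g Comp_in_Hom by blast+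
  have "f' \<cdot> g' \<cdot> (g \<cdot> f) = f' \<cdot> (g' \<cdot> (g \<cdot> f))" by (rule Comp_assoc[OF gf g(2) f(2)])
  also have "g' \<cdot> (g \<cdot> f) = f"
    using Comp_assoc[OF f(1) g(1,2)] g(3) Ident_Comp[OF f(1)] by simp
  finally have 1: "f' \<cdot> g' \<cdot> (g \<cdot> f) = Ident C X" using f(3) by simp
  have "g \<cdot> f \<cdot> (f' \<cdot> g') = g \<cdot> (f \<cdot> (f' \<cdot> g'))" by (rule Comp_assoc[OF fg f(1) g(1)])
  also have "f \<cdot> (f' \<cdot> g') = g'"
    using Comp_assoc[OF g(2) f(2,1)] f(4) Ident_Comp[OF g(2)] by simp
  finally have 2: "g \<cdot> f \<cdot> (f' \<cdot> g') = Ident C Z" using g(4) by simp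
  show ?thesis using gf fg 1 2 by (auto simp: isomorphism_def)
qed

lemma isomorphic_trans: "isomorphic C X Y \<Longrightarrow> isomorphic C Y Z \<Longrightarrow> isomorphic C X Z"
  unfolding isomorphic_def using isomorphism_comp by blast

end

lemma functor_isomorphism:
  assumes C: "category C" and F: "is_functor C D F" and a: "isomorphism C X Y a"
  shows "isomorphism D (map_obj F X) (map_obj F Y) (map_arr F a)"
proof -
  interpret category C by fact
  obtain b where b: "a \<in> Hom C X Y" "b \<in> Hom C Y X" "b \<cdot>\<^bsub>C\<^esub> a = Ident C X" "a \<cdot>\<^bsub>C\<^esub> b = Ident C Y"
    using a by (rule isomorphismE)
  show ?thesis
    using F b Hom_Obj[OF b(1)] unfolding is_functor_def isomorphism_def by metis
qed

lemma functor_faithful: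
  assumes "category C" and F: "is_functor C D F" and K: "is_functor D C K"
    and \<alpha>: "nat_iso C C (K \<circ>\<^sub>F F) id_ftor \<alpha>"
    and f: "f \<in> Hom C X Y" "f' \<in> Hom C X Y" and eq: "map_arr F f = map_arr F f'"
  shows "f = f'"
proof -
  interpret category C by fact
  have X: "X \<in> Obj C" using f Hom_Obj by blast
  have iso: "isomorphism C (map_obj K (map_obj F X)) X (\<alpha> X)"
    using \<alpha> X by (simp add: nat_iso_def comp_ftor_def id_ftor_def)
  have "\<alpha> Y \<cdot>\<^bsub>C\<^esub> map_arr K (map_arr F k) = k \<cdot>\<^bsub>C\<^esub> \<alpha> X" if "k \<in> Hom C X Y" for k
    using \<alpha> that by (simp add: nat_iso_def nat_trans_def comp_ftor_def id_ftor_def)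
  from this[OF f(1)] this[OF f(2)] show ?thesis
    using isomorphism_cancel_right[OF iso f] eq by simp
qed

text \<open>The candidate preimage of \<open>k\<close> is \<open>K k\<close> conjugated by \<open>\<alpha>\<close>; its image under \<open>F\<close> is \<open>k\<close>
  because both become equal under \<open>K\<close>, which is faithful by the other natural isomorphism.\<close>

lemma equivalence_full:
  assumes "category C" "category D" and E: "equivalence C D F"
    and X: "X \<in> Obj C" and Y: "Y \<in> Obj C" and k: "k \<in> Hom D (map_obj F X) (map_obj F Y)"
  obtains f where "f \<in> Hom C X Y" "map_arr F f = k"
proof -
  interpret C: category C by fact
  interpret D: category D by fact
  obtain K \<alpha> \<beta> where F: "is_functor C D F" and K: "is_functor D C K"
    and \<alpha>: "nat_iso C C (K \<circ>\<^sub>F F) id_ftor \<alpha>" and \<beta>: "nat_iso D D (F \<circ>\<^sub>F K) id_ftor \<beta>"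
    using E by (auto simp: equivalence_def)
  let ?KF = "\<lambda>Z. map_obj K (map_obj F Z)"
  have iso: "isomorphism C (?KF Z) Z (\<alpha> Z)" if "Z \<in> Obj C" for Z
    using \<alpha> that by (simp add: nat_iso_def comp_ftor_def id_ftor_def)
  obtain x where x: "\<alpha> X \<in> Hom C (?KF X) X" "x \<in> Hom C X (?KF X)"
    "x \<cdot>\<^bsub>C\<^esub> \<alpha> X = Ident C (?KF X)"
    using iso[OF X] by (rule C.isomorphismE)
  obtain y where y: "\<alpha> Y \<in> Hom C (?KF Y) Y" "y \<in> Hom C Y (?KF Y)"
    "y \<cdot>\<^bsub>C\<^esub> \<alpha> Y = Ident C (?KF Y)"
    using iso[OF Y] by (rule C.isomorphismE)
  have Kk: "map_arr K k \<in> Hom C (?KF X) (?KF Y)"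
    using K k by (auto simp: is_functor_def)
  define f where "f = \<alpha> Y \<cdot>\<^bsub>C\<^esub> map_arr K k \<cdot>\<^bsub>C\<^esub> x"
  have m: "\<alpha> Y \<cdot>\<^bsub>C\<^esub> map_arr K k \<in> Hom C (?KF X) Y" using C.Comp_in_Hom[OF Kk y(1)] .
  have f: "f \<in> Hom C X Y" unfolding f_def by (rule C.Comp_in_Hom[OF x(2) m])
  have Ff: "map_arr F f \<in> Hom D (map_obj F X) (map_obj F Y)"
    using F f by (auto simp: is_functor_def)
  have KFf: "map_arr K (map_arr F f) \<in> Hom C (?KF X) (?KF Y)"
    using K Ff by (auto simp: is_functor_def)
  have "\<alpha> Y \<cdot>\<^bsub>C\<^esub> map_arr K (map_arr F f) = f \<cdot>\<^bsub>C\<^esub> \<alpha> X"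
    using \<alpha> f by (simp add: nat_iso_def nat_trans_def comp_ftor_def id_ftor_def)
  also have "\<dots> = \<alpha> Y \<cdot>\<^bsub>C\<^esub> map_arr K k"
    unfolding f_def using C.Comp_assoc[OF x(1,2) m] x(3) C.Comp_Ident[OF m] by simp
  finally have eq: "\<alpha> Y \<cdot>\<^bsub>C\<^esub> map_arr K (map_arr F f) = \<alpha> Y \<cdot>\<^bsub>C\<^esub> map_arr K k" .
  have "y \<cdot>\<^bsub>C\<^esub> (\<alpha> Y \<cdot>\<^bsub>C\<^esub> h) = h" if "h \<in> Hom C (?KF X) (?KF Y)" for h
    using C.Comp_assoc[OF that y(1,2)] y(3) C.Ident_Comp[OF that] by simp
  then have "map_arr K (map_arr F f) = map_arr K k" using eq KFf Kk by metis
  then have "map_arr F f = k"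
    by (rule functor_faithful[OF \<open>category D\<close> K F \<beta> Ff k])
  then show ?thesis using f that by blast
qed

section \<open>Zero morphisms and zero objects\<close>

context additive_category
begin

lemma Zero_in_Hom:
  assumes "X \<in> Obj C" "Y \<in> Obj C"
  shows "Zero C X Y \<in> Hom C X Y"
proof -
  interpret comm_group "hom_group C X Y" using assms by (rule hom_comm_group)
  show ?thesis using one_closed by (simp add: hom_group_def)
qed

lemma Comp_Zero:
  assumes "X \<in> Obj C" "g \<in> Hom C Y Z"
  shows "g \<cdot> Zero C X Y = Zero C X Z"
proof -
  have O: "Y \<in> Obj C" "Z \<in> Obj C" using assms Hom_Obj by blast+
  interpret XY: comm_group "hom_group C X Y" using assms O by (intro hom_comm_group)
  interpret XZ: comm_group "hom_group C X Z" using assms O by (intro hom_comm_group)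
  have z: "Zero C X Y \<in> Hom C X Y" using Zero_in_Hom assms O by blast
  have "Add C (Zero C X Y) (Zero C X Y) = Zero C X Y"
    using XY.l_one[of "Zero C X Y"] z by (simp add: hom_group_def)
  then have "Add C (g \<cdot> Zero C X Y) (g \<cdot> Zero C X Y) = g \<cdot> Zero C X Y"
    using Comp_Add[OF z z assms(2)] by simp
  then show ?thesis
    using XZ.l_cancel_one[of "g \<cdot> Zero C X Y" "g \<cdot> Zero C X Y"] Comp_in_Hom[OF z assms(2)]
    by (simp add: hom_group_def)
qed

lemma Zero_Comp:
  assumes "f \<in> Hom C X Y" "Z \<in> Obj C"
  shows "Zero C Y Z \<cdot> f = Zero C X Z"
proof -
  have O: "X \<in> Obj C" "Y \<in> Obj C" using assms Hom_Obj by blast+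
  interpret YZ: comm_group "hom_group C Y Z" using assms O by (intro hom_comm_group)
  interpret XZ: comm_group "hom_group C X Z" using assms O by (intro hom_comm_group)
  have z: "Zero C Y Z \<in> Hom C Y Z" using Zero_in_Hom assms O by blast
  have "Add C (Zero C Y Z) (Zero C Y Z) = Zero C Y Z"
    using YZ.l_one[of "Zero C Y Z"] z by (simp add: hom_group_def)
  then have "Add C (Zero C Y Z \<cdot> f) (Zero C Y Z \<cdot> f) = Zero C Y Z \<cdot> f"
    using Add_Comp[OF assms(1) z z] by simp
  then show ?thesis
    using XZ.l_cancel_one[of "Zero C Y Z \<cdot> f" "Zero C Y Z \<cdot> f"] Comp_in_Hom[OF assms(1) z]
    by (simp add: hom_group_def)
qed

lemma Neg_eq: "f \<in> Hom C X Y \<Longrightarrow> Neg C f = inv\<^bsub>hom_group C X Y\<^esub> f"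
  by (auto simp: Neg_def Hom_def)

lemma Neg_in_Hom:
  assumes "f \<in> Hom C X Y"
  shows "Neg C f \<in> Hom C X Y"
proof -
  interpret comm_group "hom_group C X Y" using Hom_Obj[OF assms] by (intro hom_comm_group)
  show ?thesis using inv_closed[of f] assms Neg_eq[OF assms] by (simp add: hom_group_def)
qed

lemma Neg_Neg:
  assumes "f \<in> Hom C X Y"
  shows "Neg C (Neg C f) = f"
proof -
  interpret comm_group "hom_group C X Y" using Hom_Obj[OF assms] by (intro hom_comm_group)
  show ?thesis
    using inv_inv[of f] assms Neg_eq[OF assms] Neg_eq[OF Neg_in_Hom[OF assms]]
    by (simp add: hom_group_def)
qed

lemma Neg_Zero:
  assumes "X \<in> Obj C" "Y \<in> Obj C"
  shows "Neg C (Zero C X Y) = Zero C X Y"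
proof -
  interpret comm_group "hom_group C X Y" using assms by (intro hom_comm_group)
  show ?thesis
    using inv_one Neg_eq[OF Zero_in_Hom[OF assms]] by (simp add: hom_group_def)
qed

text \<open>Uniqueness of additive inverses is what transfers \<open>Neg\<close> across composition.\<close>

lemma NegI:
  assumes "f \<in> Hom C X Y" "g \<in> Hom C X Y" "Add C g f = Zero C X Y"
  shows "g = Neg C f"
proof -
  interpret comm_group "hom_group C X Y" using Hom_Obj[OF assms(1)] by (intro hom_comm_group)
  show ?thesis
    using inv_equality[of g f] assms Neg_eq[OF assms(1)] by (simp add: hom_group_def)
qed

lemma Add_Neg:
  assumes "f \<in> Hom C X Y"
  shows "Add C (Neg C f) f = Zero C X Y"
proof -
  interpret comm_group "hom_group C X Y" using Hom_Obj[OF assms(1)] by (intro hom_comm_group)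
  show ?thesis
    using l_inv[of f] assms Neg_eq[OF assms(1)] by (simp add: hom_group_def)
qed

lemma Comp_Neg:
  assumes f: "f \<in> Hom C X Y" and g: "g \<in> Hom C Y Z"
  shows "g \<cdot> Neg C f = Neg C (g \<cdot> f)"
proof (rule NegI)
  show "g \<cdot> f \<in> Hom C X Z" "g \<cdot> Neg C f \<in> Hom C X Z"
    using Comp_in_Hom f g Neg_in_Hom by blast+
  show "Add C (g \<cdot> Neg C f) (g \<cdot> f) = Zero C X Z"
    using Comp_Add[OF Neg_in_Hom[OF f] f g] Add_Neg[OF f] Comp_Zero[OF _ g] Hom_Obj[OF f] by simp
qed

lemma Neg_Comp:
  assumes f: "f \<in> Hom C X Y" and g: "g \<in> Hom C Y Z"
  shows "Neg C g \<cdot> f = Neg C (g \<cdot> f)"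
proof (rule NegI)
  show "g \<cdot> f \<in> Hom C X Z" "Neg C g \<cdot> f \<in> Hom C X Z"
    using Comp_in_Hom f g Neg_in_Hom by blast+
  show "Add C (Neg C g \<cdot> f) (g \<cdot> f) = Zero C X Z"
    using Add_Comp[OF f Neg_in_Hom[OF g] g] Add_Neg[OF g] Zero_Comp[OF f] Hom_Obj[OF g] by simp
qed

lemma from_Ident_Zero:
  assumes "Ident C X = Zero C X X" "f \<in> Hom C X Y"
  shows "f = Zero C X Y"
  using Comp_Ident[OF assms(2)] Comp_Zero[OF _ assms(2), of X] assms Hom_Obj by metis

lemma to_Ident_Zero:
  assumes "Ident C Y = Zero C Y Y" "f \<in> Hom C X Y"
  shows "f = Zero C X Y"
  using Ident_Comp[OF assms(2)] Zero_Comp[OF assms(2), of Y] assms Hom_Obj by metis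

lemma zero_object_iff:
  "zero_object C X \<longleftrightarrow> X \<in> Obj C \<and> Ident C X = Zero C X X"
proof
  assume "zero_object C X"
  then show "X \<in> Obj C \<and> Ident C X = Zero C X X"
    using Ident_in_Hom Zero_in_Hom unfolding zero_object_def by blast
next
  assume "X \<in> Obj C \<and> Ident C X = Zero C X X"
  then show "zero_object C X"
    using Zero_in_Hom from_Ident_Zero to_Ident_Zero unfolding zero_object_def by metis
qed

lemma zero_object_to: "zero_object C Y \<Longrightarrow> f \<in> Hom C X Y \<Longrightarrow> f = Zero C X Y"
  by (simp add: zero_object_iff to_Ident_Zero)

lemma zero_object_from: "zero_object C X \<Longrightarrow> f \<in> Hom C X Y \<Longrightarrow> f = Zero C X Y"
  by (simp add: zero_object_iff from_Ident_Zero)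

lemma zero_object_isomorphic:
  assumes "zero_object C X" "isomorphic C X Y"
  shows "zero_object C Y"
proof -
  obtain f where "isomorphism C X Y f" using assms by (auto simp: isomorphic_def)
  then obtain g where f: "f \<in> Hom C X Y" "g \<in> Hom C Y X" "f \<cdot> g = Ident C Y"
    by (rule isomorphismE)
  then have "Ident C Y = Zero C Y Y"
    using zero_object_from[OF assms(1) f(1)] Zero_Comp[OF f(2), of Y] Hom_Obj[OF f(1)] by simp
  then show ?thesis using Hom_Obj[OF f(1)] by (simp add: zero_object_iff)
qed

end

lemma additive_functor_Zero:
  assumes "additive_category C" "additive_category D" "additive_functor C D F"
    and "X \<in> Obj C" "Y \<in> Obj C"
  shows "map_arr F (Zero C X Y) = Zero D (map_obj F X) (map_obj F Y)"
proof -
  interpret C: additive_category C by fact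
  interpret D: additive_category D by fact
  have O: "map_obj F X \<in> Obj D" "map_obj F Y \<in> Obj D"
    using assms by (auto simp: additive_functor_def is_functor_def)
  have h: "map_arr F \<in> hom (hom_group C X Y) (hom_group D (map_obj F X) (map_obj F Y))"
    using assms by (auto simp: additive_functor_def)
  interpret group_hom "hom_group C X Y" "hom_group D (map_obj F X) (map_obj F Y)" "map_arr F"
    using h C.hom_comm_group[OF assms(4,5)] D.hom_comm_group[OF O]
    by (simp add: group_hom_def group_hom_axioms_def comm_group_def)
  show ?thesis using hom_one by (simp add: hom_group_def)
qed

section \<open>Exactness properties of distinguished triangles\<close>

context triangulated_category
begin

lemma dist_triangleD:
  assumes "dist_triangle C X Y Z f g h"
  shows "f \<in> Hom C X Y" "g \<in> Hom C Y Z" "h \<in> Hom C Z (sh_obj C X)"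
    "X \<in> Obj C" "Y \<in> Obj C" "Z \<in> Obj C"
  using assms Hom_Obj[of f] Hom_Obj[of g] by (auto simp: dist_triangle_def triangle_def)

lemma Shift_functor: "is_functor C C (Shift C)"
  using Shift_additive by (simp add: additive_functor_def)

lemma sh_obj_Obj: "X \<in> Obj C \<Longrightarrow> sh_obj C X \<in> Obj C"
  using Shift_functor by (simp add: is_functor_def)

lemma sh_arr_Hom: "f \<in> Hom C X Y \<Longrightarrow> sh_arr C f \<in> Hom C (sh_obj C X) (sh_obj C Y)"
  using Shift_functor by (simp add: is_functor_def)

lemma sh_arr_Ident: "X \<in> Obj C \<Longrightarrow> sh_arr C (Ident C X) = Ident C (sh_obj C X)"
  using Shift_functor by (simp add: is_functor_def)

lemma sh_arr_Comp:
  "f \<in> Hom C X Y \<Longrightarrow> g \<in> Hom C Y Z \<Longrightarrow> sh_arr C (g \<cdot> f) = sh_arr C g \<cdot> sh_arr C f"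
  using Shift_functor unfolding is_functor_def by blast

lemma sh_arr_Zero:
  "X \<in> Obj C \<Longrightarrow> Y \<in> Obj C \<Longrightarrow> sh_arr C (Zero C X Y) = Zero C (sh_obj C X) (sh_obj C Y)"
  by (rule additive_functor_Zero[OF additive_category_axioms additive_category_axioms Shift_additive])

lemma sh_arr_inject:
  assumes "f \<in> Hom C X Y" "f' \<in> Hom C X Y" "sh_arr C f = sh_arr C f'"
  shows "f = f'"
  using Shift_equivalence functor_faithful[OF category_axioms _ _ _ assms]
  unfolding equivalence_def by blast

lemma sh_arr_full:
  assumes "X \<in> Obj C" "Y \<in> Obj C" "k \<in> Hom C (sh_obj C X) (sh_obj C Y)"
  obtains f where "f \<in> Hom C X Y" "sh_arr C f = k"
  by (rule equivalence_full[OF category_axioms category_axioms Shift_equivalence assms])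

lemma sh_obj_essentially_surjective:
  assumes "X \<in> Obj C"
  obtains W where "W \<in> Obj C" "isomorphic C (sh_obj C W) X"
proof -
  obtain K \<beta> where K: "is_functor C C K" and \<beta>: "nat_iso C C (Shift C \<circ>\<^sub>F K) id_ftor \<beta>"
    using Shift_equivalence by (auto simp: equivalence_def)
  have "isomorphism C (sh_obj C (map_obj K X)) X (\<beta> X)"
    using \<beta> assms by (simp add: nat_iso_def comp_ftor_def id_ftor_def)
  moreover have "map_obj K X \<in> Obj C" using K assms by (simp add: is_functor_def)
  ultimately show ?thesis using that by (auto simp: isomorphic_def)
qed

lemma zero_object_sh_iff:
  assumes X: "X \<in> Obj C"
  shows "zero_object C (sh_obj C X) \<longleftrightarrow> zero_object C X"
proof -
  have "Ident C (sh_obj C X) = Zero C (sh_obj C X) (sh_obj C X) \<longleftrightarrow>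
      sh_arr C (Ident C X) = sh_arr C (Zero C X X)"
    by (simp add: sh_arr_Ident sh_arr_Zero X)
  also have "\<dots> \<longleftrightarrow> Ident C X = Zero C X X"
    using sh_arr_inject[OF Ident_in_Hom[OF X] Zero_in_Hom[OF X X]] by auto
  finally show ?thesis by (simp add: zero_object_iff X sh_obj_Obj)
qed

lemma rotate:
  assumes "dist_triangle C X Y Z f g h"
  shows "dist_triangle C Y Z (sh_obj C X) g h (Neg C (sh_arr C f))"
  using assms TR2 by (auto simp: dist_triangle_def)

text \<open>The rotation of this triangle is \<open>W \<rightarrow> W \<rightarrow> O'[1]\<close>, whose last vertex is again zero.\<close>

lemma dist_triangle_zero_Ident:
  assumes O: "zero_object C O'" and W: "W \<in> Obj C"
  shows "dist_triangle C O' W W (Zero C O' W) (Ident C W) (Zero C W (sh_obj C O'))"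
proof -
  have O': "O' \<in> Obj C" using O by (simp add: zero_object_def)
  have t: "triangle C O' W W (Zero C O' W) (Ident C W) (Zero C W (sh_obj C O'))"
    by (simp add: triangle_def Zero_in_Hom Ident_in_Hom O' W sh_obj_Obj)
  show ?thesis
    unfolding TR2[OF t]
    using TR1_Ident[OF W, of "sh_obj C O'"] O O' W
    by (simp add: zero_object_sh_iff sh_arr_Zero Neg_Zero sh_obj_Obj)
qed

text \<open>The square formed by \<open>id\<close> and \<open>f\<close> extends to a morphism from the triangle \<open>X \<rightarrow> X \<rightarrow> 0\<close>, whence
  \<open>g f\<close> factors through a zero object.\<close>

lemma dist_triangle_Comp_Zero:
  assumes T: "dist_triangle C X Y Z f g h"
  shows "g \<cdot> f = Zero C X Z"
proof -
  note D = dist_triangleD[OF T]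
  obtain O' where O: "zero_object C O'" using ex_zero_object by blast
  have "\<exists>c \<in> Hom C O' Z. c \<cdot> Zero C X O' = g \<cdot> f \<and>
      sh_arr C (Ident C X) \<cdot> Zero C O' (sh_obj C X) = h \<cdot> c"
    by (rule TR3[OF TR1_Ident[OF D(4) O] T Ident_in_Hom[OF D(4)] D(1)]) simp
  then show ?thesis using Comp_Zero[OF D(4)] by metis
qed

text \<open>Exactness of \<open>Hom W (-)\<close>: completing a square between the rotations of the triangles
  \<open>W \<rightarrow> W \<rightarrow> 0\<close> and \<open>X \<rightarrow> Y \<rightarrow> Z\<close> produces the lift only after a shift, and full faithfulness
  of the shift brings it back.\<close>

lemma dist_triangle_lift:
  assumes T: "dist_triangle C X Y Z f g h" and a: "a \<in> Hom C W Y" and ga: "g \<cdot> a = Zero C W Z"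
  obtains b where "b \<in> Hom C W X" "a = f \<cdot> b"
proof -
  note D = dist_triangleD[OF T]
  have W: "W \<in> Obj C" using Hom_Obj[OF a] by simp
  obtain O' where O: "zero_object C O'" using ex_zero_object by blast
  have O': "O' \<in> Obj C" using O by (simp add: zero_object_def)
  have "Zero C O' Z \<cdot> Zero C W O' = g \<cdot> a"
    using Zero_Comp[OF Zero_in_Hom[OF W O'] D(6)] ga by simp
  from TR3[OF rotate[OF TR1_Ident[OF W O]] rotate[OF T] a Zero_in_Hom[OF O' D(6)] this]
  obtain c where c: "c \<in> Hom C (sh_obj C W) (sh_obj C X)"
    and eq: "sh_arr C a \<cdot> Neg C (sh_arr C (Ident C W)) = Neg C (sh_arr C f) \<cdot> c"
    by blast
  obtain b where b: "b \<in> Hom C W X" "sh_arr C b = c" using sh_arr_full[OF W D(4) c] .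
  have fb: "f \<cdot> b \<in> Hom C W Y" using Comp_in_Hom b D by blast
  note sf = sh_arr_Hom[OF D(1)] and sa = sh_arr_Hom[OF a]
  have "Neg C (sh_arr C a) = Neg C (sh_arr C (f \<cdot> b))"
    using eq Neg_Comp[OF c sf] Comp_Neg[OF Ident_in_Hom[OF sh_obj_Obj[OF W]] sa] Comp_Ident[OF sa]
      sh_arr_Comp[OF b(1) D(1)] b(2)
    by (simp add: sh_arr_Ident W)
  then have "sh_arr C a = sh_arr C (f \<cdot> b)"
    using Neg_Neg[OF sa] Neg_Neg[OF sh_arr_Hom[OF fb]] by metis
  then have "a = f \<cdot> b" by (rule sh_arr_inject[OF a fb])
  then show ?thesis using b that by blast
qed

text \<open>Exactness of \<open>Hom (-) W\<close>: the extension is the third component of a morphism of triangles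
  from \<open>X \<rightarrow> Y \<rightarrow> Z\<close> to \<open>0 \<rightarrow> W \<rightarrow> W\<close>.\<close>

lemma dist_triangle_extend:
  assumes T: "dist_triangle C X Y Z f g h" and a: "a \<in> Hom C Y W" and af: "a \<cdot> f = Zero C X W"
  obtains b where "b \<in> Hom C Z W" "a = b \<cdot> g"
proof -
  note D = dist_triangleD[OF T]
  have W: "W \<in> Obj C" using Hom_Obj[OF a] by simp
  obtain O' where O: "zero_object C O'" using ex_zero_object by blast
  have O': "O' \<in> Obj C" using O by (simp add: zero_object_def)
  have "a \<cdot> f = Zero C O' W \<cdot> Zero C X O'"
    using Zero_Comp[OF Zero_in_Hom[OF D(4) O'] W] af by simp
  from TR3[OF T dist_triangle_zero_Ident[OF O W] Zero_in_Hom[OF D(4) O'] a this]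
  show ?thesis using that Ident_Comp[OF a] by metis
qed

text \<open>The identities of the end points of \<open>g\<close> factor through \<open>g\<close>: the one of \<open>Y\<close> since \<open>f = 0\<close>, the
  one of \<open>Z\<close> since \<open>h = 0\<close>. This and the following lemma recognize the isomorphisms in the
  triangle \<open>X \<rightarrow> M \<rightarrow> Y \<rightarrow> X[1]\<close> attached to an object of \<open>S\<^sup>\<bottom>\<close> or \<open>\<^sup>\<bottom>T\<close>.\<close>

lemma isomorphism_middle:
  assumes T: "dist_triangle C X Y Z f g h"
    and f: "f = Zero C X Y" and h: "h = Zero C Z (sh_obj C X)"
  shows "isomorphism C Y Z g"
proof -
  note D = dist_triangleD[OF T]
  obtain l where l: "l \<in> Hom C Z Y" "Ident C Y = l \<cdot> g"
    by (rule dist_triangle_extend[OF T Ident_in_Hom[OF D(5)]])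
      (use f D Comp_Zero[OF D(4) Ident_in_Hom[OF D(5)]] in auto)
  obtain r where r: "r \<in> Hom C Z Y" "Ident C Z = g \<cdot> r"
    by (rule dist_triangle_lift[OF rotate[OF T] Ident_in_Hom[OF D(6)]])
      (use h D Comp_Ident[OF D(3)] in auto)
  show ?thesis using isomorphismI_inverses[OF D(2) l(1) r(1)] l r by simp
qed

text \<open>The left inverse of \<open>f\<close> lives one shift away: since \<open>h = 0\<close>, the identity of \<open>X[1]\<close> factors
  through the third map \<open>- f[1]\<close> of the rotated triangle.\<close>

lemma isomorphism_first:
  assumes T: "dist_triangle C X Y Z f g h"
    and g: "g = Zero C Y Z" and h: "h = Zero C Z (sh_obj C X)"
  shows "isomorphism C X Y f"
proof -
  note D = dist_triangleD[OF T]
  note X1 = sh_obj_Obj[OF D(4)] and sf = sh_arr_Hom[OF D(1)]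
  obtain r where r: "r \<in> Hom C Y X" "Ident C Y = f \<cdot> r"
    by (rule dist_triangle_lift[OF T Ident_in_Hom[OF D(5)]]) (use g D Comp_Ident[OF D(2)] in auto)
  obtain k where k: "k \<in> Hom C (sh_obj C Y) (sh_obj C X)"
    "Ident C (sh_obj C X) = k \<cdot> Neg C (sh_arr C f)"
    by (rule dist_triangle_extend[OF rotate[OF rotate[OF T]] Ident_in_Hom[OF X1]])
      (use h Comp_Zero[OF D(6) Ident_in_Hom[OF X1]] in auto)
  obtain l where l: "l \<in> Hom C Y X" "sh_arr C l = Neg C k"
    using sh_arr_full[OF D(5,4) Neg_in_Hom[OF k(1)]] .
  have lf: "l \<cdot> f \<in> Hom C X X" using Comp_in_Hom D l by blast
  have "sh_arr C (l \<cdot> f) = sh_arr C (Ident C X)"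
    using sh_arr_Comp[OF D(1) l(1)] l(2) Neg_Comp[OF sf k(1)] Comp_Neg[OF sf k(1)] k(2)
    by (simp add: sh_arr_Ident D)
  then have "l \<cdot> f = Ident C X" by (rule sh_arr_inject[OF lf Ident_in_Hom[OF D(4)]])
  then show ?thesis using isomorphismI_inverses[OF D(1) l(1) r(1)] r by simp
qed

text \<open>Consecutive maps compose to zero, so invertibility of \<open>f\<close> kills both \<open>g\<close> and \<open>h\<close>. Then the
  identity of \<open>Z\<close> factors through \<open>g = 0\<close>.\<close>

lemma zero_object_cone:
  assumes T: "dist_triangle C X Y Z f g h" and iso: "isomorphism C X Y f"
  shows "zero_object C Z"
proof -
  note D = dist_triangleD[OF T]
  have g: "g = Zero C Y Z"
    using isomorphism_cancel_right[OF iso D(2) Zero_in_Hom[OF D(5,6)]]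
      dist_triangle_Comp_Zero[OF T] Zero_Comp[OF D(1,6)] by simp
  obtain f' where f': "f' \<in> Hom C Y X" "f' \<cdot> f = Ident C X" using iso by (rule isomorphismE)
  note sf = sh_arr_Hom[OF D(1)] and sf' = sh_arr_Hom[OF f'(1)]
  have "Neg C (sh_arr C f \<cdot> h) = Zero C Z (sh_obj C Y)"
    using dist_triangle_Comp_Zero[OF rotate[OF rotate[OF T]]] Neg_Comp[OF D(3) sf] by simp
  then have sfh: "sh_arr C f \<cdot> h = Zero C Z (sh_obj C Y)"
    using Neg_Neg[OF Comp_in_Hom[OF D(3) sf]] Neg_Zero[OF D(6) sh_obj_Obj[OF D(5)]] by simp
  have "h = sh_arr C (f' \<cdot> f) \<cdot> h" using f'(2) Ident_Comp[OF D(3)] by (simp add: sh_arr_Ident D)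
  also have "\<dots> = sh_arr C f' \<cdot> (sh_arr C f \<cdot> h)"
    using sh_arr_Comp[OF D(1) f'(1)] Comp_assoc[OF D(3) sf sf'] by simp
  also have "\<dots> = Zero C Z (sh_obj C X)" using sfh Comp_Zero[OF D(6) sf'] by simp
  finally have h: "h = Zero C Z (sh_obj C X)" .
  obtain r where r: "r \<in> Hom C Z Y" "Ident C Z = g \<cdot> r"
    by (rule dist_triangle_lift[OF rotate[OF T] Ident_in_Hom[OF D(6)]])
      (use h D Comp_Ident[OF D(3)] in auto)
  show ?thesis using r g Zero_Comp[OF r(1) D(6)] D by (simp add: zero_object_iff)
qed

lemma zero_object_fibre:
  assumes T: "dist_triangle C X Y Z f g h" and iso: "isomorphism C Y Z g"
  shows "zero_object C X"
  using zero_object_cone[OF rotate[OF T] iso] zero_object_sh_iff dist_triangleD(4)[OF T] by blast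

text \<open>A cone of \<open>g\<close> is isomorphic to \<open>X[1]\<close> for some \<open>X\<close>; transporting the triangle along this
  isomorphism and rotating back turns \<open>X\<close> into a fibre of \<open>g\<close>.\<close>

lemma ex_fibre:
  assumes g: "g \<in> Hom C Y Z"
  obtains X f h where "dist_triangle C X Y Z f g h"
proof -
  obtain V p q where T: "dist_triangle C Y Z V g p q" using TR1_cone[OF g] by blast
  note D = dist_triangleD[OF T]
  obtain X where X: "X \<in> Obj C" "isomorphic C (sh_obj C X) V"
    using sh_obj_essentially_surjective[OF D(6)] .
  obtain c where ci: "isomorphism C V (sh_obj C X) c"
    using isomorphic_sym[OF X(2)] by (auto simp: isomorphic_def)
  then obtain d where c: "c \<in> Hom C V (sh_obj C X)" and d: "d \<in> Hom C (sh_obj C X) V"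
    and dc: "d \<cdot> c = Ident C V" by (rule isomorphismE)
  have cp: "c \<cdot> p \<in> Hom C Z (sh_obj C X)" and qd: "q \<cdot> d \<in> Hom C (sh_obj C X) (sh_obj C Y)"
    using Comp_in_Hom c d D by blast+
  obtain f where f: "f \<in> Hom C X Y" "sh_arr C f = Neg C (q \<cdot> d)"
    using sh_arr_full[OF X(1) D(4) Neg_in_Hom[OF qd]] .
  have idY: "isomorphism C Y Y (Ident C Y)" and idZ: "isomorphism C Z Z (Ident C Z)"
    using D Ident_in_Hom Comp_Ident[OF Ident_in_Hom] by (auto simp: isomorphism_def)
  have "dist_triangle C Y Z (sh_obj C X) g (c \<cdot> p) (q \<cdot> d)"
  proof (rule TR1_iso[OF T _ idY idZ ci])
    show "triangle C Y Z (sh_obj C X) g (c \<cdot> p) (q \<cdot> d)" using g cp qd by (simp add: triangle_def)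
    show "Ident C Z \<cdot> g = g \<cdot> Ident C Y" using Ident_Comp[OF g] Comp_Ident[OF g] by simp
    show "c \<cdot> p = c \<cdot> p \<cdot> Ident C Z" using Comp_Ident[OF cp] by simp
    show "sh_arr C (Ident C Y) \<cdot> q = q \<cdot> d \<cdot> c"
      using Comp_assoc[OF c d D(3)] dc Comp_Ident[OF D(3)] Ident_Comp[OF D(3)]
      by (simp add: sh_arr_Ident D)
  qed
  moreover have "triangle C X Y Z f g (c \<cdot> p)" using f g cp by (simp add: triangle_def)
  ultimately have "dist_triangle C X Y Z f g (c \<cdot> p)"
    using TR2 f(2) Neg_Neg[OF qd] by simp
  then show ?thesis using that by blast
qed

end

section \<open>Orthogonal subcategories\<close>

definition right_orthogonal ::
  "('o, 'm, 'x) additive_category_scheme \<Rightarrow> 'o set \<Rightarrow> 'o set" where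
  "right_orthogonal C S = {Y \<in> Obj C. \<forall>X \<in> S. Hom C X Y = {Zero C X Y}}"

definition left_orthogonal ::
  "('o, 'm, 'x) additive_category_scheme \<Rightarrow> 'o set \<Rightarrow> 'o set" where
  "left_orthogonal C T = {X \<in> Obj C. \<forall>Y \<in> T. Hom C X Y = {Zero C X Y}}"

definition shift_stable ::
  "('o, 'm, 'x) triangulated_category_scheme \<Rightarrow> 'o set \<Rightarrow> bool" where
  "shift_stable C S \<longleftrightarrow> closed_under_isomorphism C S \<and>
     (\<forall>X \<in> Obj C. sh_obj C X \<in> S \<longleftrightarrow> X \<in> S)"

lemma shift_stable_subset: "shift_stable C S \<Longrightarrow> S \<subseteq> Obj C"
  unfolding shift_stable_def closed_under_isomorphism_def by blast

context additive_category
begin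

lemma right_orthogonalD:
  "Y \<in> right_orthogonal C S \<Longrightarrow> X \<in> S \<Longrightarrow> f \<in> Hom C X Y \<Longrightarrow> f = Zero C X Y"
  by (auto simp: right_orthogonal_def)

lemma left_orthogonalD:
  "X \<in> left_orthogonal C T \<Longrightarrow> Y \<in> T \<Longrightarrow> f \<in> Hom C X Y \<Longrightarrow> f = Zero C X Y"
  by (auto simp: left_orthogonal_def)

lemma right_orthogonalI:
  assumes "S \<subseteq> Obj C" "Y \<in> Obj C" "\<And>X f. X \<in> S \<Longrightarrow> f \<in> Hom C X Y \<Longrightarrow> f = Zero C X Y"
  shows "Y \<in> right_orthogonal C S"
proof -
  have "Hom C X Y = {Zero C X Y}" if "X \<in> S" for X
    using assms(1,3) that Zero_in_Hom[OF _ assms(2), of X] by blast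
  then show ?thesis using assms(2) by (simp add: right_orthogonal_def)
qed

lemma left_orthogonalI:
  assumes "T \<subseteq> Obj C" "X \<in> Obj C" "\<And>Y f. Y \<in> T \<Longrightarrow> f \<in> Hom C X Y \<Longrightarrow> f = Zero C X Y"
  shows "X \<in> left_orthogonal C T"
proof -
  have "Hom C X Y = {Zero C X Y}" if "Y \<in> T" for Y
    using assms(1,3) that Zero_in_Hom[OF assms(2), of Y] by blast
  then show ?thesis using assms(2) by (simp add: left_orthogonal_def)
qed

lemma closed_under_isomorphism_right_orthogonal:
  assumes S: "S \<subseteq> Obj C"
  shows "closed_under_isomorphism C (right_orthogonal C S)"
  unfolding closed_under_isomorphism_def
proof (intro conjI allI impI)
  show "right_orthogonal C S \<subseteq> Obj C" by (auto simp: right_orthogonal_def)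
  fix Y Y' assume "Y \<in> right_orthogonal C S \<and> isomorphic C Y Y'"
  then obtain c where Y: "Y \<in> right_orthogonal C S" and i: "isomorphism C Y Y' c"
    unfolding isomorphic_def by blast
  from i obtain d where c: "c \<in> Hom C Y Y'" and d: "d \<in> Hom C Y' Y" and cd: "c \<cdot> d = Ident C Y'"
    by (rule isomorphismE)
  have "f = Zero C X Y'" if X: "X \<in> S" and f: "f \<in> Hom C X Y'" for X f
  proof -
    have "f = c \<cdot> (d \<cdot> f)" using Comp_assoc[OF f d c] cd Ident_Comp[OF f] by simp
    also have "d \<cdot> f = Zero C X Y"
      by (rule right_orthogonalD[OF Y X Comp_in_Hom[OF f d]])
    finally show ?thesis using Comp_Zero[OF _ c] Hom_Obj[OF f] by simp
  qed
  then show "Y' \<in> right_orthogonal C S" by (rule right_orthogonalI[OF S Hom_Obj(2)[OF c]])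
qed

lemma closed_under_isomorphism_left_orthogonal:
  assumes T: "T \<subseteq> Obj C"
  shows "closed_under_isomorphism C (left_orthogonal C T)"
  unfolding closed_under_isomorphism_def
proof (intro conjI allI impI)
  show "left_orthogonal C T \<subseteq> Obj C" by (auto simp: left_orthogonal_def)
  fix X X' assume "X \<in> left_orthogonal C T \<and> isomorphic C X X'"
  then obtain c where X: "X \<in> left_orthogonal C T" and i: "isomorphism C X X' c"
    unfolding isomorphic_def by blast
  from i obtain d where c: "c \<in> Hom C X X'" and d: "d \<in> Hom C X' X" and cd: "c \<cdot> d = Ident C X'"
    by (rule isomorphismE)
  have "f = Zero C X' Y" if Y: "Y \<in> T" and f: "f \<in> Hom C X' Y" for Y f
  proof -
    have "f = f \<cdot> c \<cdot> d" using Comp_assoc[OF d c f] cd Comp_Ident[OF f] by simp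
    also have "f \<cdot> c = Zero C X Y"
      by (rule left_orthogonalD[OF X Y Comp_in_Hom[OF c f]])
    finally show ?thesis using Zero_Comp[OF d] Hom_Obj[OF f] by simp
  qed
  then show "X' \<in> left_orthogonal C T" by (rule left_orthogonalI[OF T Hom_Obj(2)[OF c]])
qed

end

context triangulated_category
begin

lemma shift_stable_unshift:
  assumes "shift_stable C S" "X \<in> S"
  obtains W where "W \<in> S" "isomorphic C (sh_obj C W) X"
proof -
  have "X \<in> Obj C" using assms shift_stable_subset by blast
  then obtain W where W: "W \<in> Obj C" "isomorphic C (sh_obj C W) X"
    using sh_obj_essentially_surjective by blast
  have "sh_obj C W \<in> S"
    using closed_under_isomorphismD assms isomorphic_sym[OF W(2)]
    unfolding shift_stable_def by metis
  then have "W \<in> S" using assms W(1) by (simp add: shift_stable_def)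
  then show ?thesis using W that by blast
qed

text \<open>Full faithfulness of the shift, as a statement about vanishing.\<close>

lemma right_orthogonal_sh_sh_iff:
  assumes X: "X \<in> Obj C" and Y: "Y \<in> Obj C"
  shows "sh_obj C Y \<in> right_orthogonal C {sh_obj C X} \<longleftrightarrow> Y \<in> right_orthogonal C {X}"
proof
  assume L: "sh_obj C Y \<in> right_orthogonal C {sh_obj C X}"
  show "Y \<in> right_orthogonal C {X}"
  proof (rule right_orthogonalI)
    fix X' f assume "X' \<in> {X}" and f: "f \<in> Hom C X' Y"
    then have f: "f \<in> Hom C X Y" and [simp]: "X' = X" by auto
    have "sh_arr C f = sh_arr C (Zero C X Y)"
      using right_orthogonalD[OF L _ sh_arr_Hom[OF f]] sh_arr_Zero[OF X Y] by simp
    then show "f = Zero C X' Y" using sh_arr_inject[OF f Zero_in_Hom[OF X Y]] by simp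
  qed (use X Y in auto)
next
  assume R: "Y \<in> right_orthogonal C {X}"
  show "sh_obj C Y \<in> right_orthogonal C {sh_obj C X}"
  proof (rule right_orthogonalI)
    fix X' k assume "X' \<in> {sh_obj C X}" and "k \<in> Hom C X' (sh_obj C Y)"
    then have k: "k \<in> Hom C (sh_obj C X) (sh_obj C Y)" and [simp]: "X' = sh_obj C X" by auto
    obtain f where f: "f \<in> Hom C X Y" "sh_arr C f = k" using sh_arr_full[OF X Y k] .
    then have "f = Zero C X Y" using right_orthogonalD[OF R] by simp
    then show "k = Zero C X' (sh_obj C Y)" using f(2) sh_arr_Zero[OF X Y] by simp
  qed (use X Y sh_obj_Obj in auto)
qed

text \<open>A morphism from \<open>X \<in> S\<close> to \<open>Y[1]\<close> can be unshifted only after \<open>X\<close> is replaced by an isomorphic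
  \<open>W[1]\<close> with \<open>W \<in> S\<close>, and this uses that \<open>S\<close> is stable under the inverse shift.\<close>

lemma shift_stable_right_orthogonal:
  assumes S: "shift_stable C S"
  shows "shift_stable C (right_orthogonal C S)"
proof -
  have SO: "S \<subseteq> Obj C" using S by (rule shift_stable_subset)
  have "sh_obj C Y \<in> right_orthogonal C S \<longleftrightarrow> Y \<in> right_orthogonal C S" if Y: "Y \<in> Obj C" for Y
  proof
    assume *: "sh_obj C Y \<in> right_orthogonal C S"
    have "Y \<in> right_orthogonal C {X}" if "X \<in> S" for X
    proof -
      have X: "X \<in> Obj C" using SO that by auto
      then have "sh_obj C X \<in> S" using S that by (simp add: shift_stable_def)
      then show ?thesis
        using * unfolding right_orthogonal_sh_sh_iff[OF X Y, symmetric]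
        by (simp add: right_orthogonal_def)
    qed
    then show "Y \<in> right_orthogonal C S" using Y by (simp add: right_orthogonal_def)
  next
    assume *: "Y \<in> right_orthogonal C S"
    have "X \<in> left_orthogonal C {sh_obj C Y}" if X: "X \<in> S" for X
    proof -
      obtain W where W: "W \<in> S" "isomorphic C (sh_obj C W) X"
        using shift_stable_unshift[OF S X] .
      have WO: "W \<in> Obj C" using W SO by auto
      have "Y \<in> right_orthogonal C {W}" using * W by (simp add: right_orthogonal_def)
      then have "sh_obj C W \<in> left_orthogonal C {sh_obj C Y}"
        unfolding right_orthogonal_sh_sh_iff[OF WO Y, symmetric]
        using sh_obj_Obj[OF WO] by (simp add: right_orthogonal_def left_orthogonal_def)
      then show ?thesis
        using closed_under_isomorphismD[OF closed_under_isomorphism_left_orthogonal _ W(2)]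
          sh_obj_Obj[OF Y] by simp
    qed
    then show "sh_obj C Y \<in> right_orthogonal C S"
      using sh_obj_Obj[OF Y] by (simp add: right_orthogonal_def left_orthogonal_def)
  qed
  then show ?thesis
    using closed_under_isomorphism_right_orthogonal[OF SO] by (simp add: shift_stable_def)
qed

lemma shift_stable_left_orthogonal:
  assumes T: "shift_stable C T"
  shows "shift_stable C (left_orthogonal C T)"
proof -
  have TO: "T \<subseteq> Obj C" using T by (rule shift_stable_subset)
  have "sh_obj C X \<in> left_orthogonal C T \<longleftrightarrow> X \<in> left_orthogonal C T" if X: "X \<in> Obj C" for X
  proof
    assume *: "sh_obj C X \<in> left_orthogonal C T"
    have "Y \<in> right_orthogonal C {X}" if "Y \<in> T" for Y
    proof -
      have Y: "Y \<in> Obj C" using TO that by auto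
      then have "sh_obj C Y \<in> T" using T that by (simp add: shift_stable_def)
      then show ?thesis
        using * sh_obj_Obj[OF Y] unfolding right_orthogonal_sh_sh_iff[OF X Y, symmetric]
        by (simp add: right_orthogonal_def left_orthogonal_def)
    qed
    then show "X \<in> left_orthogonal C T"
      using X by (simp add: right_orthogonal_def left_orthogonal_def)
  next
    assume *: "X \<in> left_orthogonal C T"
    have "Y \<in> right_orthogonal C {sh_obj C X}" if Y: "Y \<in> T" for Y
    proof -
      obtain W where W: "W \<in> T" "isomorphic C (sh_obj C W) Y"
        using shift_stable_unshift[OF T Y] .
      have WO: "W \<in> Obj C" using W TO by auto
      have "W \<in> right_orthogonal C {X}"
        using * W WO by (simp add: left_orthogonal_def right_orthogonal_def)
      then have "sh_obj C W \<in> right_orthogonal C {sh_obj C X}"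
        unfolding right_orthogonal_sh_sh_iff[OF X WO] .
      then show ?thesis
        using closed_under_isomorphismD[OF closed_under_isomorphism_right_orthogonal _ W(2)]
          sh_obj_Obj[OF X] by simp
    qed
    then show "sh_obj C X \<in> left_orthogonal C T"
      using sh_obj_Obj[OF X] by (simp add: right_orthogonal_def left_orthogonal_def)
  qed
  then show ?thesis
    using closed_under_isomorphism_left_orthogonal[OF TO] by (simp add: shift_stable_def)
qed

text \<open>For \<open>W \<in> S\<close> and a triangle \<open>X \<rightarrow> Y \<rightarrow> Z \<rightarrow> X[1]\<close>, the group \<open>Hom(W, Z)\<close> lies between
  \<open>Hom(W, Y) = 0\<close> and \<open>Hom(W, X[1]) = 0\<close> in the long exact sequence.\<close>

lemma triangulated_subcategory_right_orthogonal:
  assumes S: "shift_stable C S"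
  shows "triangulated_subcategory C (right_orthogonal C S)"
proof -
  have SO: "S \<subseteq> Obj C" using S by (rule shift_stable_subset)
  note st = shift_stable_right_orthogonal[OF S]
  obtain Z where Z: "zero_object C Z" using ex_zero_object by blast
  have "Z \<in> right_orthogonal C S"
    using right_orthogonalI[OF SO _ zero_object_to[OF Z]] Z by (simp add: zero_object_def)
  moreover have "Z \<in> right_orthogonal C S"
    if T: "dist_triangle C X Y Z f g h"
      and X: "X \<in> right_orthogonal C S" and Y: "Y \<in> right_orthogonal C S" for X Y Z f g h
  proof -
    note D = dist_triangleD[OF T]
    have X1: "sh_obj C X \<in> right_orthogonal C S" using st D X by (simp add: shift_stable_def)
    have "a = Zero C W Z" if W: "W \<in> S" and a: "a \<in> Hom C W Z" for W a
    proof -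
      have "h \<cdot> a = Zero C W (sh_obj C X)"
        by (rule right_orthogonalD[OF X1 W Comp_in_Hom[OF a D(3)]])
      then obtain b where b: "b \<in> Hom C W Y" "a = g \<cdot> b"
        using dist_triangle_lift[OF rotate[OF T] a] by blast
      have "b = Zero C W Y" by (rule right_orthogonalD[OF Y W b(1)])
      then show ?thesis using b Comp_Zero[OF _ D(2)] Hom_Obj[OF a] by simp
    qed
    then show ?thesis by (rule right_orthogonalI[OF SO D(6)])
  qed
  ultimately show ?thesis
    using st Z unfolding triangulated_subcategory_def shift_stable_def closed_under_isomorphism_def
    by blast
qed

text \<open>Here \<open>Hom(Z, W)\<close> lies between \<open>Hom(X[1], W) = 0\<close> and \<open>Hom(Y, W) = 0\<close>.\<close>

lemma triangulated_subcategory_left_orthogonal: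
  assumes T: "shift_stable C T"
  shows "triangulated_subcategory C (left_orthogonal C T)"
proof -
  have TO: "T \<subseteq> Obj C" using T by (rule shift_stable_subset)
  note st = shift_stable_left_orthogonal[OF T]
  obtain Z where Z: "zero_object C Z" using ex_zero_object by blast
  have "Z \<in> left_orthogonal C T"
    using left_orthogonalI[OF TO _ zero_object_from[OF Z]] Z by (simp add: zero_object_def)
  moreover have "Z \<in> left_orthogonal C T"
    if XYZ: "dist_triangle C X Y Z f g h"
      and X: "X \<in> left_orthogonal C T" and Y: "Y \<in> left_orthogonal C T" for X Y Z f g h
  proof -
    note D = dist_triangleD[OF XYZ]
    have X1: "sh_obj C X \<in> left_orthogonal C T" using st D X by (simp add: shift_stable_def)
    have "a = Zero C Z W" if W: "W \<in> T" and a: "a \<in> Hom C Z W" for W a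
    proof -
      have "a \<cdot> g = Zero C Y W"
        by (rule left_orthogonalD[OF Y W Comp_in_Hom[OF D(2) a]])
      then obtain b where b: "b \<in> Hom C (sh_obj C X) W" "a = b \<cdot> h"
        using dist_triangle_extend[OF rotate[OF XYZ] a] by blast
      have "b = Zero C (sh_obj C X) W" by (rule left_orthogonalD[OF X1 W b(1)])
      then show ?thesis using b Zero_Comp[OF D(3)] Hom_Obj[OF a] by simp
    qed
    then show ?thesis by (rule left_orthogonalI[OF TO D(6)])
  qed
  ultimately show ?thesis
    using st Z unfolding triangulated_subcategory_def shift_stable_def closed_under_isomorphism_def
    by blast
qed

section \<open>Orthogonal pairs with decomposition triangles\<close>

text \<open>Let \<open>A \<in> S\<^sup>\<bottom>\<close> with triangle \<open>X \<rightarrow> A \<rightarrow> Y \<rightarrow> X[1]\<close>. The first map vanishes, so the identity of \<open>X[1]\<close>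
  lifts along the connecting map to some \<open>X[1] \<rightarrow> Y\<close>, which is zero. Hence \<open>X[1] = 0\<close>, the connecting
  map vanishes, and \<open>A \<cong> Y\<close>. Shift stability enters through the condition
  \<open>Hom(X[1], Y) = 0\<close>, which follows from the stability of either \<open>S\<close> or \<open>T\<close>.\<close>

lemma right_orthogonal_eq:
  assumes S: "S \<subseteq> Obj C" and T: "closed_under_isomorphism C T"
    and orth: "T \<subseteq> right_orthogonal C S"
    and sh: "\<And>X. X \<in> S \<Longrightarrow> sh_obj C X \<in> left_orthogonal C T"
    and tri: "\<And>A. A \<in> Obj C \<Longrightarrow> \<exists>X \<in> S. \<exists>Y \<in> T. \<exists>f g h. dist_triangle C X A Y f g h"
  shows "right_orthogonal C S = T"
proof
  have TO: "T \<subseteq> Obj C" using T by (rule closed_under_isomorphism_subset)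
  show "right_orthogonal C S \<subseteq> T"
  proof
    fix A assume A: "A \<in> right_orthogonal C S"
    then have "A \<in> Obj C" by (simp add: right_orthogonal_def)
    then obtain X Y f g h where X: "X \<in> S" and Y: "Y \<in> T" and XAY: "dist_triangle C X A Y f g h"
      using tri by blast
    note D = dist_triangleD[OF XAY]
    let ?X1 = "sh_obj C X"
    have X1: "?X1 \<in> Obj C" using sh_obj_Obj D by blast
    have f: "f = Zero C X A" by (rule right_orthogonalD[OF A X D(1)])
    have "Neg C (sh_arr C f) \<cdot> Ident C ?X1 = Zero C ?X1 (sh_obj C A)"
      using f D X1 Comp_Ident[OF Zero_in_Hom[OF X1 sh_obj_Obj[OF D(5)]]]
      by (simp add: sh_arr_Zero Neg_Zero sh_obj_Obj)
    then obtain s where s: "s \<in> Hom C ?X1 Y" "Ident C ?X1 = h \<cdot> s"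
      using dist_triangle_lift[OF rotate[OF rotate[OF XAY]] Ident_in_Hom[OF X1]] by blast
    have "s = Zero C ?X1 Y" by (rule left_orthogonalD[OF sh[OF X] Y s(1)])
    then have "Ident C ?X1 = Zero C ?X1 ?X1" using s Comp_Zero[OF X1 D(3)] by simp
    then have "h = Zero C Y ?X1" using to_Ident_Zero D by blast
    then have "isomorphic C A Y" using isomorphism_middle[OF XAY f] by (auto simp: isomorphic_def)
    then show "A \<in> T" by (rule closed_under_isomorphismD[OF T Y isomorphic_sym])
  qed
qed (rule orth)

text \<open>Dually, \<open>A \<in> \<^sup>\<bottom>T\<close> kills the map \<open>A \<rightarrow> Y\<close>, so the identity of \<open>Y\<close> factors through the connecting
  map and a morphism \<open>X[1] \<rightarrow> Y\<close>, which is zero. Hence \<open>Y = 0\<close> and \<open>X \<cong> A\<close>.\<close>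

lemma left_orthogonal_eq:
  assumes S: "closed_under_isomorphism C S" and T: "T \<subseteq> Obj C"
    and orth: "S \<subseteq> left_orthogonal C T"
    and sh: "\<And>X. X \<in> S \<Longrightarrow> sh_obj C X \<in> left_orthogonal C T"
    and tri: "\<And>A. A \<in> Obj C \<Longrightarrow> \<exists>X \<in> S. \<exists>Y \<in> T. \<exists>f g h. dist_triangle C X A Y f g h"
  shows "left_orthogonal C T = S"
proof
  show "left_orthogonal C T \<subseteq> S"
  proof
    fix A assume A: "A \<in> left_orthogonal C T"
    then have "A \<in> Obj C" by (simp add: left_orthogonal_def)
    then obtain X Y f g h where X: "X \<in> S" and Y: "Y \<in> T" and XAY: "dist_triangle C X A Y f g h"
      using tri by blast
    note D = dist_triangleD[OF XAY]
    let ?X1 = "sh_obj C X"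
    have g: "g = Zero C A Y" by (rule left_orthogonalD[OF A Y D(2)])
    have "Ident C Y \<cdot> g = Zero C A Y" using g Ident_Comp[OF D(2)] by simp
    then obtain b where b: "b \<in> Hom C ?X1 Y" "Ident C Y = b \<cdot> h"
      using dist_triangle_extend[OF rotate[OF XAY] Ident_in_Hom[OF D(6)]] by blast
    have "b = Zero C ?X1 Y" by (rule left_orthogonalD[OF sh[OF X] Y b(1)])
    then have "Ident C Y = Zero C Y Y" using b Zero_Comp[OF D(3,6)] by simp
    then have "h = Zero C Y ?X1" using from_Ident_Zero D by blast
    then have "isomorphic C X A" using isomorphism_first[OF XAY g] by (auto simp: isomorphic_def)
    then show "A \<in> S" by (rule closed_under_isomorphismD[OF S X])
  qed
qed (rule orth)

text \<open>A triangle \<open>X \<rightarrow> A \<rightarrow> Y\<close> is the same as a chain \<open>0 \<rightarrow> X \<rightarrow> A\<close> with cones \<open>X \<in> S\<close> and \<open>Y \<in> T\<close>. As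
  the cone of the last map belongs to the first component, the order is \<open>(T, S)\<close>.\<close>

lemma semiorthogonal_decomposition_pair:
  assumes S: "triangulated_subcategory C S" and T: "triangulated_subcategory C T"
    and orth: "\<And>X Y. X \<in> S \<Longrightarrow> Y \<in> T \<Longrightarrow> Hom C X Y = {Zero C X Y}"
    and tri: "\<And>A. A \<in> Obj C \<Longrightarrow> \<exists>X \<in> S. \<exists>Y \<in> T. \<exists>f g h. dist_triangle C X A Y f g h"
  shows "semiorthogonal_decomposition C [T, S]"
proof -
  have two: "{1..length [T, S]} = {1, 2}" by auto
  have chain: "\<exists>X f. X 0 = A \<and> zero_object C (X (length [T, S])) \<and>
        (\<forall>i \<in> {1..length [T, S]}. f i \<in> Hom C (X i) (X (i - 1)) \<and>
           (\<exists>Z g h. dist_triangle C (X i) (X (i - 1)) Z (f i) g h \<and> Z \<in> [T, S] ! (i - 1)))"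
    if "A \<in> Obj C" for A
  proof -
    obtain X1 Y f g h where X1: "X1 \<in> S" and Y: "Y \<in> T" and X1AY: "dist_triangle C X1 A Y f g h"
      using tri[OF \<open>A \<in> Obj C\<close>] by blast
    note D = dist_triangleD[OF X1AY]
    obtain O' where O: "zero_object C O'" using ex_zero_object by blast
    note E = dist_triangle_zero_Ident[OF O D(4)]
    define X where "X i = (if i = 0 then A else if i = 1 then X1 else O')" for i :: nat
    define k where "k i = (if i = 1 then f else Zero C O' X1)" for i :: nat
    have "X 0 = A \<and> zero_object C (X (length [T, S])) \<and>
        (\<forall>i \<in> {1..length [T, S]}. k i \<in> Hom C (X i) (X (i - 1)) \<and>
           (\<exists>Z g h. dist_triangle C (X i) (X (i - 1)) Z (k i) g h \<and> Z \<in> [T, S] ! (i - 1)))"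
      unfolding two using X1AY E D(1) dist_triangleD(1)[OF E] O X1 Y
      by (auto simp: X_def k_def)
    then show ?thesis by blast
  qed
  have "Hom C X Y = {Zero C X Y}"
    if "i \<in> {1..length [T, S]}" "j \<in> {1..length [T, S]}" "i > j"
      "X \<in> [T, S] ! (i - 1)" "Y \<in> [T, S] ! (j - 1)" for i j X Y
    using that orth unfolding two by auto
  then show ?thesis
    using S T chain unfolding semiorthogonal_decomposition_def by auto
qed

text \<open>Shift stability of either member gives \<open>Hom(X[1], Y) = 0\<close>, hence both orthogonality equations,
  and these pass shift stability on to the other member. Each member is then the orthogonal of a
  shift-stable set, hence triangulated.\<close>

theorem semiorthogonal_decompositionI:
  assumes S: "closed_under_isomorphism C S" and T: "closed_under_isomorphism C T"
    and stable: "shift_stable C S \<or> shift_stable C T"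
    and orth: "\<And>X Y. X \<in> S \<Longrightarrow> Y \<in> T \<Longrightarrow> Hom C X Y = {Zero C X Y}"
    and tri: "\<And>A. A \<in> Obj C \<Longrightarrow> \<exists>X \<in> S. \<exists>Y \<in> T. \<exists>f g h. dist_triangle C X A Y f g h"
  shows "semiorthogonal_decomposition C [T, S]"
proof -
  have SO: "S \<subseteq> Obj C" and TO: "T \<subseteq> Obj C"
    using S T closed_under_isomorphism_subset by blast+
  have ST: "S \<subseteq> left_orthogonal C T" and TS: "T \<subseteq> right_orthogonal C S"
    using SO TO orth by (auto simp: left_orthogonal_def right_orthogonal_def)
  have sh: "sh_obj C X \<in> left_orthogonal C T" if "X \<in> S" for X
    using stable
  proof
    assume "shift_stable C S"
    then show ?thesis using that SO ST by (auto simp: shift_stable_def)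
  next
    assume "shift_stable C T"
    then show ?thesis
      using shift_stable_left_orthogonal that SO ST by (auto simp: shift_stable_def)
  qed
  have R: "right_orthogonal C S = T" by (rule right_orthogonal_eq[OF SO T TS sh tri])
  have L: "left_orthogonal C T = S" by (rule left_orthogonal_eq[OF S TO ST sh tri])
  have "shift_stable C S \<and> shift_stable C T"
    using stable shift_stable_right_orthogonal[of S] shift_stable_left_orthogonal[of T] L R by auto
  then have "triangulated_subcategory C S" "triangulated_subcategory C T"
    using triangulated_subcategory_right_orthogonal[of S]
      triangulated_subcategory_left_orthogonal[of T] L R by auto
  then show ?thesis by (rule semiorthogonal_decomposition_pair[OF _ _ orth tri])
qed

end

section \<open>Kernels of exact functors and images of adjoints\<close>

lemma closed_under_isomorphism_essential_image:
  assumes "category C"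
  shows "closed_under_isomorphism C (essential_image D C F)"
  unfolding closed_under_isomorphism_def
proof (intro conjI allI impI)
  interpret category C by fact
  show "essential_image D C F \<subseteq> Obj C" by (auto simp: essential_image_def)
  fix X Y assume XY: "X \<in> essential_image D C F \<and> isomorphic C X Y"
  then obtain W where W: "W \<in> Obj D" "isomorphic C X (map_obj F W)"
    by (auto simp: essential_image_def)
  have "isomorphic C Y (map_obj F W)"
    using isomorphic_trans[OF isomorphic_sym W(2)] XY by blast
  moreover have "Y \<in> Obj C"
    using XY Hom_Obj(2) unfolding isomorphic_def isomorphism_def by blast
  ultimately show "Y \<in> essential_image D C F" using W(1) by (auto simp: essential_image_def)
qed

lemma functor_in_essential_image:
  assumes "category C" "is_functor D C F" "Y \<in> Obj D"
  shows "map_obj F Y \<in> essential_image D C F"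
proof -
  have "map_obj F Y \<in> Obj C" using assms(2,3) by (simp add: is_functor_def)
  then show ?thesis
    using category.isomorphic_refl[OF assms(1)] assms(3) by (auto simp: essential_image_def)
qed

lemma functor_kernel_iff:
  assumes "additive_category D" "is_functor C D G"
  shows "X \<in> functor_kernel C D G \<longleftrightarrow> X \<in> Obj C \<and> zero_object D (map_obj G X)"
proof -
  interpret D: additive_category D by fact
  have "zero_object D (map_obj G X)" if "zero_object D Z" "isomorphic D (map_obj G X) Z" for Z
    using D.zero_object_isomorphic[OF that(1) D.isomorphic_sym[OF that(2)]] .
  moreover have "isomorphic D (map_obj G X) (map_obj G X)" if "X \<in> Obj C"
    using assms(2) that by (intro D.isomorphic_refl) (simp add: is_functor_def)
  ultimately show ?thesis unfolding functor_kernel_def by auto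
qed

lemma shift_stable_functor_kernel:
  assumes C: "triangulated_category C" and D: "triangulated_category D" and G: "exact_functor C D G"
  shows "shift_stable C (functor_kernel C D G)"
proof -
  interpret C: triangulated_category C by fact
  interpret D: triangulated_category D by fact
  obtain \<theta> where \<theta>: "nat_iso C D (G \<circ>\<^sub>F Shift C) (Shift D \<circ>\<^sub>F G) \<theta>" and F: "is_functor C D G"
    using G by (auto simp: exact_functor_def additive_functor_def)
  note ker = functor_kernel_iff[OF D.additive_category_axioms F]
  have "sh_obj C X \<in> functor_kernel C D G \<longleftrightarrow> X \<in> functor_kernel C D G" if X: "X \<in> Obj C" for X
  proof -
    have GX: "map_obj G X \<in> Obj D" using F X by (simp add: is_functor_def)
    have "isomorphic D (map_obj G (sh_obj C X)) (sh_obj D (map_obj G X))"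
      using \<theta> X by (auto simp: nat_iso_def comp_ftor_def isomorphic_def)
    then have "zero_object D (map_obj G (sh_obj C X)) \<longleftrightarrow> zero_object D (sh_obj D (map_obj G X))"
      using D.zero_object_isomorphic D.isomorphic_sym by metis
    then show ?thesis by (simp add: ker X C.sh_obj_Obj D.zero_object_sh_iff[OF GX])
  qed
  moreover have "functor_kernel C D G \<subseteq> Obj C" by (auto simp: functor_kernel_def)
  moreover have "Y \<in> functor_kernel C D G"
    if X: "X \<in> functor_kernel C D G" and XY: "isomorphic C X Y" for X Y
  proof -
    obtain f where f: "isomorphism C X Y f" using XY by (auto simp: isomorphic_def)
    then have "Y \<in> Obj C" using C.Hom_Obj by (auto simp: isomorphism_def)
    moreover have "isomorphic D (map_obj G X) (map_obj G Y)"
      using functor_isomorphism[OF C.category_axioms F f] by (auto simp: isomorphic_def)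
    ultimately show ?thesis using X D.zero_object_isomorphic unfolding ker by blast
  qed
  ultimately show ?thesis
    unfolding shift_stable_def closed_under_isomorphism_def by blast
qed

text \<open>A morphism \<open>k : X \<rightarrow> F Y\<close> is recovered from its transpose \<open>\<epsilon>\<^sub>Y \<circ> G k : G X \<rightarrow> Y\<close>, and there is only
  one morphism out of \<open>G X = 0\<close>. So \<open>k\<close> has the same transpose as the zero morphism; the
  detour through a second transpose is there because \<open>F\<close> is not known to preserve zero morphisms.\<close>

lemma adjunction_Hom_kernel_zero:
  assumes "additive_category C" "additive_category D" and adj: "adjunction C D G F \<eta> \<epsilon>"
    and X: "X \<in> functor_kernel C D G" and Y: "Y \<in> Obj D" and f: "f \<in> Hom C X (map_obj F Y)"
  shows "f = Zero C X (map_obj F Y)"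
proof -
  interpret C: additive_category C by fact
  interpret D: additive_category D by fact
  have G: "is_functor C D G" and F: "is_functor D C F" using adj by (auto simp: adjunction_def)
  have XO: "X \<in> Obj C" and GX: "zero_object D (map_obj G X)"
    using X by (simp_all add: functor_kernel_iff[OF D.additive_category_axioms G])
  have FY: "map_obj F Y \<in> Obj C" using F Y by (simp add: is_functor_def)
  let ?GFY = "map_obj G (map_obj F Y)" and ?FGFY = "map_obj F (map_obj G (map_obj F Y))"
  have \<epsilon>: "\<epsilon> Y \<in> Hom D ?GFY Y" and \<eta>: "\<eta> (map_obj F Y) \<in> Hom C (map_obj F Y) ?FGFY"
    and nat: "\<And>k. k \<in> Hom C X (map_obj F Y) \<Longrightarrow>
      \<eta> (map_obj F Y) \<cdot>\<^bsub>C\<^esub> k = map_arr F (map_arr G k) \<cdot>\<^bsub>C\<^esub> \<eta> X"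
    and \<eta>X: "\<eta> X \<in> Hom C X (map_obj F (map_obj G X))"
    and id: "map_arr F (\<epsilon> Y) \<cdot>\<^bsub>C\<^esub> \<eta> (map_obj F Y) = Ident C (map_obj F Y)"
    using adj Y FY XO by (auto simp: adjunction_def nat_trans_def comp_ftor_def id_ftor_def)
  have F\<epsilon>: "map_arr F (\<epsilon> Y) \<in> Hom C ?FGFY (map_obj F Y)"
    using F \<epsilon> by (simp add: is_functor_def)
  have transpose: "k = map_arr F (Zero D (map_obj G X) Y) \<cdot>\<^bsub>C\<^esub> \<eta> X"
    if k: "k \<in> Hom C X (map_obj F Y)" for k
  proof -
    have Gk: "map_arr G k \<in> Hom D (map_obj G X) ?GFY" using G k by (simp add: is_functor_def)
    have FGk: "map_arr F (map_arr G k) \<in> Hom C (map_obj F (map_obj G X)) ?FGFY"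
      using F Gk by (simp add: is_functor_def)
    have "k = map_arr F (\<epsilon> Y) \<cdot>\<^bsub>C\<^esub> (\<eta> (map_obj F Y) \<cdot>\<^bsub>C\<^esub> k)"
      using C.Comp_assoc[OF k \<eta> F\<epsilon>] id C.Ident_Comp[OF k] by simp
    also have "\<dots> = map_arr F (\<epsilon> Y) \<cdot>\<^bsub>C\<^esub> map_arr F (map_arr G k) \<cdot>\<^bsub>C\<^esub> \<eta> X"
      using nat[OF k] C.Comp_assoc[OF \<eta>X FGk F\<epsilon>] by simp
    also have "map_arr F (\<epsilon> Y) \<cdot>\<^bsub>C\<^esub> map_arr F (map_arr G k) = map_arr F (\<epsilon> Y \<cdot>\<^bsub>D\<^esub> map_arr G k)"
      using F Gk \<epsilon> unfolding is_functor_def by metis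
    also have "\<epsilon> Y \<cdot>\<^bsub>D\<^esub> map_arr G k = Zero D (map_obj G X) Y"
      by (rule D.zero_object_from[OF GX D.Comp_in_Hom[OF Gk \<epsilon>]])
    finally show ?thesis .
  qed
  show ?thesis using transpose[OF f] transpose[OF C.Zero_in_Hom[OF XO FY]] by simp
qed

text \<open>The same comparison for a left adjoint: \<open>k : F Y \<rightarrow> X\<close> is recovered from
  \<open>G k \<circ> \<eta>\<^sub>Y : Y \<rightarrow> G X = 0\<close>.\<close>

lemma adjunction_Hom_zero_kernel:
  assumes "additive_category C" "additive_category D" and adj: "adjunction D C F G \<eta> \<epsilon>"
    and X: "X \<in> functor_kernel C D G" and Y: "Y \<in> Obj D" and f: "f \<in> Hom C (map_obj F Y) X"
  shows "f = Zero C (map_obj F Y) X"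
proof -
  interpret C: additive_category C by fact
  interpret D: additive_category D by fact
  have G: "is_functor C D G" and F: "is_functor D C F" using adj by (auto simp: adjunction_def)
  have XO: "X \<in> Obj C" and GX: "zero_object D (map_obj G X)"
    using X by (simp_all add: functor_kernel_iff[OF D.additive_category_axioms G])
  have FY: "map_obj F Y \<in> Obj C" using F Y by (simp add: is_functor_def)
  let ?GFY = "map_obj G (map_obj F Y)" and ?FGFY = "map_obj F (map_obj G (map_obj F Y))"
  have \<eta>: "\<eta> Y \<in> Hom D Y ?GFY" and \<epsilon>: "\<epsilon> (map_obj F Y) \<in> Hom C ?FGFY (map_obj F Y)"
    and nat: "\<And>k. k \<in> Hom C (map_obj F Y) X \<Longrightarrow>
      \<epsilon> X \<cdot>\<^bsub>C\<^esub> map_arr F (map_arr G k) = k \<cdot>\<^bsub>C\<^esub> \<epsilon> (map_obj F Y)"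
    and \<epsilon>X: "\<epsilon> X \<in> Hom C (map_obj F (map_obj G X)) X"
    and id: "\<epsilon> (map_obj F Y) \<cdot>\<^bsub>C\<^esub> map_arr F (\<eta> Y) = Ident C (map_obj F Y)"
    using adj Y FY XO by (auto simp: adjunction_def nat_trans_def comp_ftor_def id_ftor_def)
  have F\<eta>: "map_arr F (\<eta> Y) \<in> Hom C (map_obj F Y) ?FGFY"
    using F \<eta> by (simp add: is_functor_def)
  have transpose: "k = \<epsilon> X \<cdot>\<^bsub>C\<^esub> map_arr F (Zero D Y (map_obj G X))"
    if k: "k \<in> Hom C (map_obj F Y) X" for k
  proof -
    have Gk: "map_arr G k \<in> Hom D ?GFY (map_obj G X)" using G k by (simp add: is_functor_def)
    have FGk: "map_arr F (map_arr G k) \<in> Hom C ?FGFY (map_obj F (map_obj G X))"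
      using F Gk by (simp add: is_functor_def)
    have "k = k \<cdot>\<^bsub>C\<^esub> \<epsilon> (map_obj F Y) \<cdot>\<^bsub>C\<^esub> map_arr F (\<eta> Y)"
      using C.Comp_assoc[OF F\<eta> \<epsilon> k] id C.Comp_Ident[OF k] by simp
    also have "\<dots> = \<epsilon> X \<cdot>\<^bsub>C\<^esub> (map_arr F (map_arr G k) \<cdot>\<^bsub>C\<^esub> map_arr F (\<eta> Y))"
      using nat[OF k] C.Comp_assoc[OF F\<eta> FGk \<epsilon>X] by simp
    also have "map_arr F (map_arr G k) \<cdot>\<^bsub>C\<^esub> map_arr F (\<eta> Y) = map_arr F (map_arr G k \<cdot>\<^bsub>D\<^esub> \<eta> Y)"
      using F Gk \<eta> unfolding is_functor_def by metis
    also have "map_arr G k \<cdot>\<^bsub>D\<^esub> \<eta> Y = Zero D Y (map_obj G X)"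
      by (rule D.zero_object_to[OF GX D.Comp_in_Hom[OF \<eta> Gk]])
    finally show ?thesis .
  qed
  show ?thesis using transpose[OF f] transpose[OF C.Zero_in_Hom[OF FY XO]] by simp
qed

text \<open>The object \<open>M\<close> is decomposed by a fibre of the unit \<open>M \<rightarrow> F G M\<close>. The triangle identity
  \<open>\<epsilon>\<^bsub>G M\<^esub> \<circ> G \<eta>\<^sub>M = id\<close> identifies \<open>G \<eta>\<^sub>M\<close> with the inverse of the isomorphism \<open>\<epsilon>\<^bsub>G M\<^esub>\<close>, so
  \<open>G\<close> kills the fibre.\<close>

lemma semiorthogonal_decomposition_right_adjoint:
  assumes A: "triangulated_category A" and B: "triangulated_category B" and G: "exact_functor A B G"
    and adj: "adjunction A B G F \<eta> \<epsilon>" and counit: "nat_iso B B (G \<circ>\<^sub>F F) id_ftor \<epsilon>"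
  shows "semiorthogonal_decomposition A [essential_image B A F, functor_kernel A B G]"
proof -
  interpret A: triangulated_category A by fact
  interpret B: triangulated_category B by fact
  let ?K = "functor_kernel A B G" and ?I = "essential_image B A F"
  have GF: "is_functor A B G" and FF: "is_functor B A F" using adj by (auto simp: adjunction_def)
  note ker = functor_kernel_iff[OF B.additive_category_axioms GF]
  have st: "shift_stable A ?K" by (rule shift_stable_functor_kernel[OF A B G])
  then have K: "closed_under_isomorphism A ?K" by (simp add: shift_stable_def)
  then have KO: "?K \<subseteq> Obj A" by (rule closed_under_isomorphism_subset)
  have orth: "Hom A X Y = {Zero A X Y}" if X: "X \<in> ?K" and Y: "Y \<in> ?I" for X Y
  proof -
    obtain Y' where Y': "Y' \<in> Obj B" "isomorphic A Y (map_obj F Y')"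
      using Y by (auto simp: essential_image_def)
    have "map_obj F Y' \<in> right_orthogonal A ?K"
    proof (rule A.right_orthogonalI[OF KO])
      show "map_obj F Y' \<in> Obj A" using FF Y'(1) by (simp add: is_functor_def)
    qed (rule adjunction_Hom_kernel_zero[OF A.additive_category_axioms B.additive_category_axioms
          adj _ Y'(1)])
    then have "Y \<in> right_orthogonal A ?K"
      by (rule closed_under_isomorphismD[OF A.closed_under_isomorphism_right_orthogonal[OF KO] _
            A.isomorphic_sym[OF Y'(2)]])
    then show ?thesis using X by (simp add: right_orthogonal_def)
  qed
  have tri: "\<exists>X \<in> ?K. \<exists>Y \<in> ?I. \<exists>f g h. dist_triangle A X M Y f g h" if M: "M \<in> Obj A" for M
  proof -
    let ?GM = "map_obj G M" and ?FGM = "map_obj F (map_obj G M)"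
    have GM: "?GM \<in> Obj B" using GF M by (simp add: is_functor_def)
    have \<eta>: "\<eta> M \<in> Hom A M ?FGM"
      using adj M by (simp add: adjunction_def nat_trans_def comp_ftor_def id_ftor_def)
    obtain X f h where T: "dist_triangle A X M ?FGM f (\<eta> M) h" using A.ex_fibre[OF \<eta>] .
    have "isomorphism B (map_obj G ?FGM) ?GM (\<epsilon> ?GM)"
      using counit GM by (simp add: nat_iso_def comp_ftor_def id_ftor_def)
    then obtain e where \<epsilon>: "\<epsilon> ?GM \<in> Hom B (map_obj G ?FGM) ?GM"
      and e: "e \<in> Hom B ?GM (map_obj G ?FGM)" and e\<epsilon>: "e \<cdot>\<^bsub>B\<^esub> \<epsilon> ?GM = Ident B (map_obj G ?FGM)"
      and \<epsilon>e: "\<epsilon> ?GM \<cdot>\<^bsub>B\<^esub> e = Ident B ?GM"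
      by (rule B.isomorphismE)
    have G\<eta>: "map_arr G (\<eta> M) \<in> Hom B ?GM (map_obj G ?FGM)" using GF \<eta> by (simp add: is_functor_def)
    have "\<epsilon> ?GM \<cdot>\<^bsub>B\<^esub> map_arr G (\<eta> M) = Ident B ?GM" using adj M by (simp add: adjunction_def)
    then have "map_arr G (\<eta> M) = e"
      using B.Comp_assoc[OF G\<eta> \<epsilon> e] e\<epsilon> B.Ident_Comp[OF G\<eta>] B.Comp_Ident[OF e] by simp
    then have "isomorphism B ?GM (map_obj G ?FGM) (map_arr G (\<eta> M))"
      using e \<epsilon> e\<epsilon> \<epsilon>e by (auto simp: isomorphism_def)
    moreover obtain k where "dist_triangle B (map_obj G X) ?GM (map_obj G ?FGM)
        (map_arr G f) (map_arr G (\<eta> M)) k"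
      using G T unfolding exact_functor_def by blast
    ultimately have "zero_object B (map_obj G X)" using B.zero_object_fibre by blast
    then have "X \<in> ?K" using A.dist_triangleD[OF T] by (simp add: ker)
    then show ?thesis
      using T functor_in_essential_image[OF A.category_axioms FF GM] by blast
  qed
  show ?thesis
    using A.semiorthogonal_decompositionI[OF K
        closed_under_isomorphism_essential_image[OF A.category_axioms] disjI1[OF st] orth tri] .
qed

text \<open>The object \<open>M\<close> is decomposed by a cone of the counit \<open>F G M \<rightarrow> M\<close>, which \<open>G\<close> kills because
  \<open>G \<epsilon>\<^sub>M \<circ> \<eta>\<^bsub>G M\<^esub> = id\<close> and \<open>\<eta>\<^bsub>G M\<^esub>\<close> is invertible.\<close>

lemma semiorthogonal_decomposition_left_adjoint:
  assumes A: "triangulated_category A" and B: "triangulated_category B" and G: "exact_functor A B G"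
    and adj: "adjunction B A F G \<eta> \<epsilon>" and unit: "nat_iso B B id_ftor (G \<circ>\<^sub>F F) \<eta>"
  shows "semiorthogonal_decomposition A [functor_kernel A B G, essential_image B A F]"
proof -
  interpret A: triangulated_category A by fact
  interpret B: triangulated_category B by fact
  let ?K = "functor_kernel A B G" and ?I = "essential_image B A F"
  have GF: "is_functor A B G" and FF: "is_functor B A F" using adj by (auto simp: adjunction_def)
  note ker = functor_kernel_iff[OF B.additive_category_axioms GF]
  have st: "shift_stable A ?K" by (rule shift_stable_functor_kernel[OF A B G])
  then have K: "closed_under_isomorphism A ?K" by (simp add: shift_stable_def)
  then have KO: "?K \<subseteq> Obj A" by (rule closed_under_isomorphism_subset)
  have orth: "Hom A Y X = {Zero A Y X}" if Y: "Y \<in> ?I" and X: "X \<in> ?K" for Y X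
  proof -
    obtain Y' where Y': "Y' \<in> Obj B" "isomorphic A Y (map_obj F Y')"
      using Y by (auto simp: essential_image_def)
    have "map_obj F Y' \<in> left_orthogonal A ?K"
    proof (rule A.left_orthogonalI[OF KO])
      show "map_obj F Y' \<in> Obj A" using FF Y'(1) by (simp add: is_functor_def)
    qed (rule adjunction_Hom_zero_kernel[OF A.additive_category_axioms B.additive_category_axioms
          adj _ Y'(1)])
    then have "Y \<in> left_orthogonal A ?K"
      by (rule closed_under_isomorphismD[OF A.closed_under_isomorphism_left_orthogonal[OF KO] _
            A.isomorphic_sym[OF Y'(2)]])
    then show ?thesis using X by (simp add: left_orthogonal_def)
  qed
  have tri: "\<exists>Y \<in> ?I. \<exists>X \<in> ?K. \<exists>f g h. dist_triangle A Y M X f g h" if M: "M \<in> Obj A" for M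
  proof -
    let ?GM = "map_obj G M" and ?FGM = "map_obj F (map_obj G M)"
    have GM: "?GM \<in> Obj B" using GF M by (simp add: is_functor_def)
    have \<epsilon>: "\<epsilon> M \<in> Hom A ?FGM M"
      using adj M by (simp add: adjunction_def nat_trans_def comp_ftor_def id_ftor_def)
    obtain X g h where T: "dist_triangle A ?FGM M X (\<epsilon> M) g h" using A.TR1_cone[OF \<epsilon>] by blast
    have "isomorphism B ?GM (map_obj G ?FGM) (\<eta> ?GM)"
      using unit GM by (simp add: nat_iso_def comp_ftor_def id_ftor_def)
    then obtain e where \<eta>: "\<eta> ?GM \<in> Hom B ?GM (map_obj G ?FGM)"
      and e: "e \<in> Hom B (map_obj G ?FGM) ?GM" and e\<eta>: "e \<cdot>\<^bsub>B\<^esub> \<eta> ?GM = Ident B ?GM"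
      and \<eta>e: "\<eta> ?GM \<cdot>\<^bsub>B\<^esub> e = Ident B (map_obj G ?FGM)"
      by (rule B.isomorphismE)
    have G\<epsilon>: "map_arr G (\<epsilon> M) \<in> Hom B (map_obj G ?FGM) ?GM" using GF \<epsilon> by (simp add: is_functor_def)
    have "map_arr G (\<epsilon> M) \<cdot>\<^bsub>B\<^esub> \<eta> ?GM = Ident B ?GM" using adj M by (simp add: adjunction_def)
    then have "map_arr G (\<epsilon> M) = e"
      using B.Comp_assoc[OF e \<eta> G\<epsilon>] \<eta>e B.Comp_Ident[OF G\<epsilon>] B.Ident_Comp[OF e] by simp
    then have "isomorphism B (map_obj G ?FGM) ?GM (map_arr G (\<epsilon> M))"
      using e \<eta> e\<eta> \<eta>e by (auto simp: isomorphism_def)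
    moreover obtain k where "dist_triangle B (map_obj G ?FGM) ?GM (map_obj G X)
        (map_arr G (\<epsilon> M)) (map_arr G g) k"
      using G T unfolding exact_functor_def by blast
    ultimately have "zero_object B (map_obj G X)" using B.zero_object_cone by blast
    then have "X \<in> ?K" using A.dist_triangleD[OF T] by (simp add: ker)
    then show ?thesis
      using T functor_in_essential_image[OF A.category_axioms FF GM] by blast
  qed
  show ?thesis
    using A.semiorthogonal_decompositionI[OF
        closed_under_isomorphism_essential_image[OF A.category_axioms] K disjI2[OF st] orth tri] .
qed

theorem corollary2p6:
  fixes A :: "('a, 'm) triangulated_category"
    and B :: "('b, 'n) triangulated_category"
    and G :: "('a, 'm, 'b, 'n) ftor"
  assumes "triangulated_category A" and "triangulated_category B"
    and "exact_functor A B G"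
  shows "(\<forall>F \<eta> \<epsilon>. adjunction A B G F \<eta> \<epsilon> \<and> nat_iso B B (G \<circ>\<^sub>F F) id_ftor \<epsilon> \<longrightarrow>
            semiorthogonal_decomposition A [essential_image B A F, functor_kernel A B G]) \<and>
         (\<forall>F \<eta> \<epsilon>. adjunction B A F G \<eta> \<epsilon> \<and> nat_iso B B id_ftor (G \<circ>\<^sub>F F) \<eta> \<longrightarrow>
            semiorthogonal_decomposition A [functor_kernel A B G, essential_image B A F])"
  using semiorthogonal_decomposition_right_adjoint[OF assms]
    semiorthogonal_decomposition_left_adjoint[OF assms] by blast

end
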